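(* Let $\mathrm{SNR}>0$ and $0\le R\le C$. Consider the ensembles $\Omega^{(n)}_{\mathrm I}(R)$ of random spherical codes and take the region to be the cone $\mathcal C(\theta^r_{\mathrm{AWGN}}(R))$. Then (1') $\bar P^{\,r}_{\mathrm{union}}\ \dot\le\ \exp\big(-nE^r_{\mathrm{AWGN}}(R;\mathrm{SNR})\big)$, and (2') $\bar P^{\,r}_{\mathrm{union}}\ \dot\ge\ P_{\mathrm{region}}$.
   Context: Logarithms natural, rates in nats. AWGN channel $\mathbf y=\mathbf c+\mathbf z$ in $\mathbb R^n$, $\mathbf z$ with i.i.d. $N(0,\sigma^2)$ components, power $P$, $\mathrm{SNR}=P/\sigma^2$, $C=\frac12\log(1+\mathrm{SNR})$, $R_{\mathrm{crit}}=\frac12\log\big(\frac12+\frac{\mathrm{SNR}}4+\frac12\sqrt{1+\frac{\mathrm{SNR}^2}4}\big)$. $f\,\dot\le\,g$ means $\limsup_n\frac1n\log(f(n)/g(n))\le0$, and $f\,\dot\ge\,g$ means $g\,\dot\le\,f$. $\theta(R)$: $\sin\theta(R)=e^{-R}$. $\theta^r_{\mathrm{AWGN}}(R)=\pi/2$ if $0\le R\le R_{\mathrm{crit}}$, $=\theta(R)$ if $R_{\mathrm{crit}}<R\le C$. $\Omega^{(n)}_{\mathrm I}(R)$: codebooks of $e^{nR}$ codewords drawn i.i.d. uniformly on the sphere of radius $\sqrt{nP}$. $\mathcal C_{\mathbf c}(\theta)$: cone with apex at the origin, axis through $\mathbf c$, half-angle $\theta$. $P_{\mathrm{region}}=\Pr(\mathbf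 c+\mathbf z\notin\mathcal C_{\mathbf c}(\theta))$ (independent of $\mathbf c$), and $\bar P^{\,r}_{\mathrm{union}}=\mathbb E\Big[\frac1{|\mathcal C|}\sum_{\mathbf c\in\mathcal C}\sum_{\mathbf c_e\in\mathcal C\setminus\{\mathbf c\}}\Pr\big(\|\mathbf c+\mathbf z-\mathbf c_e\|\le\|\mathbf z\|,\ \mathbf c+\mathbf z\in\mathcal C_{\mathbf c}(\theta)\big)\Big]$, expectation over the ensemble. $E_G(\beta,\rho)=\frac12[(1-\beta)(1+\rho)+\mathrm{SNR}+\rho\log\beta+\log(\beta-\frac{\mathrm{SNR}}{1+\rho})-2\rho R]$; $E_{\mathrm{sp}}(R;\mathrm{SNR})=E_G(\beta_G,\rho_G)$ with $\beta_G=e^{2R}$, $\rho_G=\frac{\mathrm{SNR}}{2\beta_G}(1+\sqrt{1+\frac{4\beta_G}{\mathrm{SNR}(\beta_G-1)}})-1$; $E_r(R;\mathrm{SNR})=E_G(\beta'_G,1)$ with $\beta'_G=\frac12\big(1+\frac{\mathrm{SNR}}2+\sqrt{1+\frac{\mathrm{SNR}^2}4}\big)$. The random coding exponent is $E^r_{\mathrm{AWGN}}(R;\mathrm{SNR})=E_r(R;\mathrm{SNR})$ for $0\le R\le R_{\mathrm{crit}}$ and $=E_{\mathrm{sp}}(R;\mathrm{SNR})$ for $R_{\mathrm{crit}}<R\le C$.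
   Formalization: At R = 0 there is a single codeword, so the union bound is 0 while P_region > 0 and (2') fails as written; the formal version of (2') carries content only for 0 < R ≤ C, being true at R = 0 by a convention for division by zero. *)

theory Defs
  imports "HOL-Probability.Probability"
begin

definition vnorm :: "nat \<Rightarrow> (nat \<Rightarrow> real) \<Rightarrow> real" where
  "vnorm n x = sqrt (\<Sum>i<n. (x i)\<^sup>2)"

definition vinner :: "nat \<Rightarrow> (nat \<Rightarrow> real) \<Rightarrow> (nat \<Rightarrow> real) \<Rightarrow> real" where
  "vinner n x y = (\<Sum>i<n. x i * y i)"

text \<open>Closed cone with apex at the origin, axis through c, half-angle th (0 \<le> th \<le> pi):
  the set of y whose angle with c is at most th.\<close>
definition cone :: "nat \<Rightarrow> (nat \<Rightarrow> real) \<Rightarrow> real \<Rightarrow> (nat \<Rightarrow> real) set" where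
  "cone n c th = {y. vinner n y c \<ge> vnorm n y * vnorm n c * cos th}"

definition gauss_vec :: "nat \<Rightarrow> real \<Rightarrow> (nat \<Rightarrow> real) measure" where
  "gauss_vec n \<sigma> = PiM {..<n} (\<lambda>_. density lborel (normal_density 0 \<sigma>))"

text \<open>Uniform distribution on the sphere of radius sqrt(n P) in R^n, realised as the
  normalised standard Gaussian vector (the rotation-invariant probability on the sphere).\<close>
definition sphere_unif :: "nat \<Rightarrow> real \<Rightarrow> (nat \<Rightarrow> real) measure" where
  "sphere_unif n P = distr (gauss_vec n 1) (PiM {..<n} (\<lambda>_. lborel))
      (\<lambda>x. \<lambda>i\<in>{..<n}. sqrt (real n * P) * x i / vnorm n x)"

definition ncw :: "nat \<Rightarrow> real \<Rightarrow> nat" where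
  "ncw n R = nat \<lceil>exp (real n * R)\<rceil>"

definition codebook_ens :: "nat \<Rightarrow> real \<Rightarrow> real \<Rightarrow> (nat \<Rightarrow> nat \<Rightarrow> real) measure" where
  "codebook_ens n P R = PiM {..<ncw n R} (\<lambda>_. sphere_unif n P)"

definition pair_err :: "nat \<Rightarrow> real \<Rightarrow> real \<Rightarrow> (nat \<Rightarrow> real) \<Rightarrow> (nat \<Rightarrow> real) \<Rightarrow> real" where
  "pair_err n \<sigma> th c ce = measure (gauss_vec n \<sigma>)
     {z \<in> space (gauss_vec n \<sigma>).
        vnorm n (\<lambda>i. c i + z i - ce i) \<le> vnorm n z \<and> (\<lambda>i. c i + z i) \<in> cone n c th}"

definition P_union :: "nat \<Rightarrow> real \<Rightarrow> real \<Rightarrow> real \<Rightarrow> real \<Rightarrow> real" where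
  "P_union n P \<sigma> R th =
     (\<integral>cb. (1 / real (ncw n R)) *
        (\<Sum>i<ncw n R. \<Sum>j\<in>{..<ncw n R} - {i}. pair_err n \<sigma> th (cb i) (cb j))
      \<partial>codebook_ens n P R)"

text \<open>P_region (independent of the codeword; evaluated at sqrt(nP) e_0).\<close>
definition P_region :: "nat \<Rightarrow> real \<Rightarrow> real \<Rightarrow> real \<Rightarrow> real" where
  "P_region n P \<sigma> th =
     (let c0 = (\<lambda>i::nat. if i = 0 then sqrt (real n * P) else 0) in
      measure (gauss_vec n \<sigma>)
        {z \<in> space (gauss_vec n \<sigma>). (\<lambda>i. c0 i + z i) \<notin> cone n c0 th})"

definition exp_le :: "(nat \<Rightarrow> real) \<Rightarrow> (nat \<Rightarrow> real) \<Rightarrow> bool" where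
  "exp_le f g \<longleftrightarrow>
     limsup (\<lambda>n. if f n / g n > 0 then ereal (ln (f n / g n) / real n) else -\<infinity>) \<le> 0"

definition cap :: "real \<Rightarrow> real" where
  "cap snr = ln (1 + snr) / 2"

definition Rcrit :: "real \<Rightarrow> real" where
  "Rcrit snr = ln (1/2 + snr/4 + sqrt (1 + snr\<^sup>2 / 4) / 2) / 2"

definition theta :: "real \<Rightarrow> real" where
  "theta R = arcsin (exp (- R))"

definition theta_r :: "real \<Rightarrow> real \<Rightarrow> real" where
  "theta_r snr R = (if R \<le> Rcrit snr then pi / 2 else theta R)"

definition E_G :: "real \<Rightarrow> real \<Rightarrow> real \<Rightarrow> real \<Rightarrow> real" where
  "E_G snr R \<beta> \<rho> = ((1 - \<beta>) * (1 + \<rho>) + snr + \<rho> * ln \<beta> + ln (\<beta> - snr / (1 + \<rho>)) - 2 * \<rho> * R) / 2"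

definition E_sp :: "real \<Rightarrow> real \<Rightarrow> real" where
  "E_sp R snr = (let \<beta> = exp (2 * R);
                     \<rho> = snr / (2 * \<beta>) * (1 + sqrt (1 + 4 * \<beta> / (snr * (\<beta> - 1)))) - 1
                 in E_G snr R \<beta> \<rho>)"

definition E_r :: "real \<Rightarrow> real \<Rightarrow> real" where
  "E_r R snr = E_G snr R ((1 + snr / 2 + sqrt (1 + snr\<^sup>2 / 4)) / 2) 1"

definition E_awgn_r :: "real \<Rightarrow> real \<Rightarrow> real" where
  "E_awgn_r R snr = (if R \<le> Rcrit snr then E_r R snr else E_sp R snr)"

end

theory Submission
  imports Defs
begin

text \<open>
  Both bounds rest on product-form Gaussian integrals, so no rotation invariance is needed and all
  estimates are uniform in the transmitted codeword c.

  A received vector y at angle \<phi> from c is closer to an independent uniform codeword with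
  probability at most 2 sqrt n (sin \<phi>)^(n-1), a Chernoff bound for the quadratic form
  <u,g>^2 - cos^2 \<phi> |g|^2. Since sin^2 \<phi> is the minimum over s of |c - s y|^2 / |c|^2, it is bounded
  by a quadratic function of the noise whose exponential moments are explicit, and the choice
  s = SNR / (\<beta> (1 + \<rho>)) produces exactly the exponent E_G. The same moment bounds P_region when R
  exceeds the critical rate.

  Conversely, tilting the noise to mean a sqrt n along c and variance v concentrates it near one
  point of the boundary of the cone, and tilting the competing codeword does the same for the cap.
  The parameters a and v read off from the exponential moment make the exponents agree.
\<close>

text \<open>The cap bound contributes the power (\<beta> sin^2 \<phi>)^((n-1)/2), while product-form
  Gaussian integrals evaluate only exponentials of quadratic functions. The bridge is w \<le> exp
  (\<rho> (w - 1)). With \<rho> = 1 it holds for all w, so up to the critical rate a half-space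
  suffices as region. With \<rho> < 1 it fails just above w = 1, so the noise has to be confined to
  \<beta> sin^2 \<phi> \<le> 1; for \<beta> = e^(2R) this reads sin \<phi> \<le> e^(-R), which is
  where the cone of half-angle \<theta>(R) comes from. The value of \<beta> is a stationary point of
  E_G in \<beta>. Stationarity makes the Gaussian moment collapse to E_G, and it also puts the mean
  of the tilted received vector exactly on the boundary of the cone when \<beta> = e^(2R). Since the
  lower bound needs an open condition, the tilt is pushed slightly into the cone and continuity of
  the rate absorbs the loss.\<close>

section \<open>Subexponential comparison of sequences\<close>

text \<open>Indices with \<open>g n = 0\<close> impose nothing, because there the quotient is 0 and
  its logarithmic rate counts as minus infinity; \<open>g n \<ge> 0\<close> turns a positive
  quotient into a positive denominator.\<close>

lemma exp_leI:
  assumes "\<And>e. e > 0 \<Longrightarrow> \<forall>\<^sub>F n in sequentially. g n > 0 \<longrightarrow> f n \<le> exp (real n * e) * g n"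
    and g: "\<And>n. g n \<ge> 0"
  shows "exp_le f g"
  unfolding exp_le_def
proof (rule ereal_le_epsilon2)
  fix e :: real assume e: "e > 0"
  have "\<forall>\<^sub>F n in sequentially. (if f n / g n > 0 then ereal (ln (f n / g n) / real n) else - \<infinity>) \<le> ereal e"
    using assms(1)[OF e] eventually_gt_at_top[of 0]
  proof eventually_elim
    case (elim n)
    show ?case
    proof (cases "f n / g n > 0")
      case True
      then have "g n > 0" using g[of n] by (auto simp: zero_less_divide_iff)
      with elim have "f n / g n \<le> exp (real n * e)"
        by (simp add: field_simps)
      then have "ln (f n / g n) \<le> real n * e"
        using True by (metis ln_exp ln_mono exp_gt_zero)
      then show ?thesis using True elim by (simp add: field_simps)
    qed simp
  qed
  then have "limsup (\<lambda>n. if f n / g n > 0 then ereal (ln (f n / g n) / real n) else - \<infinity>) \<le> ereal e"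
    by (rule Limsup_bounded)
  then show "limsup (\<lambda>n. if f n / g n > 0 then ereal (ln (f n / g n) / real n) else - \<infinity>) \<le> 0 + ereal e"
    by simp
qed

section \<open>Gaussian vectors\<close>

abbreviation gauss1 :: "real \<Rightarrow> real \<Rightarrow> real measure" where
  "gauss1 \<mu> \<sigma> \<equiv> density lborel (normal_density \<mu> \<sigma>)"

definition gauss :: "nat \<Rightarrow> (nat \<Rightarrow> real) \<Rightarrow> real \<Rightarrow> (nat \<Rightarrow> real) measure" where
  "gauss n \<mu> \<sigma> = PiM {..<n} (\<lambda>i. gauss1 (\<mu> i) \<sigma>)"

lemma gauss_vec_eq: "gauss_vec n \<sigma> = gauss n (\<lambda>_. 0) \<sigma>"
  by (simp add: gauss_vec_def gauss_def)

lemma sets_gauss [measurable_cong, simp]: "sets (gauss n \<mu> \<sigma>) = sets (PiM {..<n} (\<lambda>_. borel))"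
  unfolding gauss_def by (intro sets_PiM_cong) auto

lemma space_gauss: "space (gauss n \<mu> \<sigma>) = {..<n} \<rightarrow>\<^sub>E UNIV"
  unfolding gauss_def by (simp add: space_PiM)

lemma prob_space_gauss: "\<sigma> > 0 \<Longrightarrow> prob_space (gauss n \<mu> \<sigma>)"
  unfolding gauss_def by (intro prob_space_PiM prob_space_normal_density)

lemma product_sigma_finite_gauss1: "\<sigma> > 0 \<Longrightarrow> product_sigma_finite (\<lambda>i. gauss1 (\<mu> i) \<sigma>)"
  by (simp add: product_sigma_finite_def prob_space_normal_density prob_space_imp_sigma_finite)

lemma nn_integral_normal_density:
  "\<sigma> > 0 \<Longrightarrow> (\<integral>\<^sup>+x. ennreal (normal_density \<mu> \<sigma> x) \<partial>lborel) = 1"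
  using prob_space.emeasure_space_1[OF prob_space_normal_density[of \<sigma> \<mu>]]
  by (simp add: emeasure_density)

text \<open>Completing the square leaves a normal density of variance \<sigma>^2 / k and mean
  shifted by b \<sigma>^2 / k, whose mass is 1. This tilted law later supplies the parameters of the
  matching lower bound.\<close>

lemma gauss1_mgf:
  assumes s: "\<sigma> > 0" and k: "k = 1 - 2 * a * \<sigma>\<^sup>2" "k > 0"
  shows "(\<integral>\<^sup>+x. ennreal (exp (a * (x - \<mu>)\<^sup>2 + b * (x - \<mu>))) \<partial>gauss1 \<mu> \<sigma>)
    = ennreal (exp (b\<^sup>2 * \<sigma>\<^sup>2 / (2 * k)) / sqrt k)"
proof -
  let ?m = "\<mu> + b * \<sigma>\<^sup>2 / k" and ?s = "\<sigma> / sqrt k"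
  have s': "?s > 0" using s k by simp
  have key: "normal_density \<mu> \<sigma> x * exp (a * (x - \<mu>)\<^sup>2 + b * (x - \<mu>))
     = exp (b\<^sup>2 * \<sigma>\<^sup>2 / (2 * k)) / sqrt k * normal_density ?m ?s x" for x
  proof -
    define t where "t = x - \<mu>"
    have a: "a = (1 - k) / (2 * \<sigma>\<^sup>2)" using k s by (simp add: field_simps)
    have sk: "?s\<^sup>2 = \<sigma>\<^sup>2 / k" using k by (simp add: power_divide)
    have 1: "-(x - \<mu>)\<^sup>2 / (2 * \<sigma>\<^sup>2) + (a * (x - \<mu>)\<^sup>2 + b * (x - \<mu>))
      = b\<^sup>2 * \<sigma>\<^sup>2 / (2 * k) + (-(x - ?m)\<^sup>2 / (2 * ?s\<^sup>2))"
      unfolding sk a diff_diff_eq[symmetric] t_def[symmetric] using k s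
      by (simp add: field_simps power2_eq_square)
    have 2: "sqrt (2 * pi * ?s\<^sup>2) = sqrt (2 * pi * \<sigma>\<^sup>2) / sqrt k"
      unfolding sk by (simp add: real_sqrt_divide)
    show ?thesis
      unfolding normal_density_def 2 using k
      by (simp add: exp_add[symmetric] 1 del: exp_add) (simp add: 1[simplified] exp_add[symmetric])
  qed
  have "(\<integral>\<^sup>+x. ennreal (exp (a * (x - \<mu>)\<^sup>2 + b * (x - \<mu>))) \<partial>gauss1 \<mu> \<sigma>)
     = (\<integral>\<^sup>+x. ennreal (exp (b\<^sup>2 * \<sigma>\<^sup>2 / (2 * k)) / sqrt k) * ennreal (normal_density ?m ?s x) \<partial>lborel)"
    by (subst nn_integral_density)
       (auto intro!: nn_integral_cong simp: ennreal_mult[symmetric] key less_imp_le[OF k(2)])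
  also have "\<dots> = ennreal (exp (b\<^sup>2 * \<sigma>\<^sup>2 / (2 * k)) / sqrt k)"
    by (subst nn_integral_cmult) (auto simp: nn_integral_normal_density[OF s'])
  finally show ?thesis .
qed

lemma gauss_mgf:
  assumes s: "\<sigma> > 0" and k: "k = 1 - 2 * a * \<sigma>\<^sup>2" "k > 0"
  shows "(\<integral>\<^sup>+x. ennreal (exp (a * (\<Sum>i<n. (x i - \<mu> i)\<^sup>2) + (\<Sum>i<n. b i * (x i - \<mu> i)))) \<partial>gauss n \<mu> \<sigma>)
    = ennreal (exp ((\<Sum>i<n. (b i)\<^sup>2) * \<sigma>\<^sup>2 / (2 * k)) / sqrt k ^ n)"
proof -
  interpret product_sigma_finite "\<lambda>i. gauss1 (\<mu> i) \<sigma>"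
    by (rule product_sigma_finite_gauss1[OF s])
  have "(\<integral>\<^sup>+x. ennreal (exp (a * (\<Sum>i<n. (x i - \<mu> i)\<^sup>2) + (\<Sum>i<n. b i * (x i - \<mu> i)))) \<partial>gauss n \<mu> \<sigma>)
     = (\<integral>\<^sup>+x. (\<Prod>i<n. ennreal (exp (a * (x i - \<mu> i)\<^sup>2 + b i * (x i - \<mu> i)))) \<partial>gauss n \<mu> \<sigma>)"
    by (simp add: prod_ennreal exp_sum[symmetric] sum.distrib sum_distrib_left)
  also have "\<dots> = (\<Prod>i<n. \<integral>\<^sup>+x. ennreal (exp (a * (x - \<mu> i)\<^sup>2 + b i * (x - \<mu> i))) \<partial>gauss1 (\<mu> i) \<sigma>)"
    unfolding gauss_def by (subst product_nn_integral_prod) auto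
  also have "\<dots> = (\<Prod>i<n. ennreal (exp ((b i)\<^sup>2 * \<sigma>\<^sup>2 / (2 * k)) / sqrt k))"
    by (simp add: gauss1_mgf[OF assms])
  also have "\<dots> = ennreal (exp ((\<Sum>i<n. (b i)\<^sup>2) * \<sigma>\<^sup>2 / (2 * k)) / sqrt k ^ n)"
    using k by (simp add: prod_ennreal prod_dividef exp_sum[symmetric] sum_distrib_right sum_divide_distrib)
  finally show ?thesis .
qed

lemma emeasure_le_nn_integral_exp:
  assumes "h \<in> borel_measurable M"
  shows "emeasure M {x \<in> space M. 0 \<le> h x} \<le> (\<integral>\<^sup>+x. ennreal (exp (h x)) \<partial>M)"
proof -
  have "emeasure M {x \<in> space M. 0 \<le> h x} = (\<integral>\<^sup>+x. indicator {x \<in> space M. 0 \<le> h x} x \<partial>M)"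
    using assms by simp
  also have "\<dots> \<le> (\<integral>\<^sup>+x. ennreal (exp (h x)) \<partial>M)"
    by (intro nn_integral_mono) (auto simp: indicator_def)
  finally show ?thesis .
qed

lemma pred_le_real [measurable]:
  fixes f g :: "'a \<Rightarrow> real"
  assumes "f \<in> borel_measurable M" "g \<in> borel_measurable M"
  shows "Measurable.pred M (\<lambda>x. f x \<le> g x)"
  using assms by measurable

lemma measurable_vinner:
  assumes "\<And>i. i < n \<Longrightarrow> (\<lambda>x. f x i) \<in> borel_measurable M"
    and "\<And>i. i < n \<Longrightarrow> (\<lambda>x. g x i) \<in> borel_measurable M"
  shows "(\<lambda>x. vinner n (f x) (g x)) \<in> borel_measurable M"
  unfolding vinner_def using assms by measurable

lemma measurable_vnorm:
  assumes "\<And>i. i < n \<Longrightarrow> (\<lambda>x. f x i) \<in> borel_measurable M"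
  shows "(\<lambda>x. vnorm n (f x)) \<in> borel_measurable M"
  unfolding vnorm_def using assms by measurable

lemma measurable_vinner_id [measurable]: "(\<lambda>x. vinner n u x) \<in> borel_measurable (PiM {..<n} (\<lambda>_. borel))"
  by (rule measurable_vinner) measurable

lemma measurable_vnorm_id [measurable]: "(\<lambda>x. vnorm n x) \<in> borel_measurable (PiM {..<n} (\<lambda>_. borel))"
  by (rule measurable_vnorm) measurable

lemma vnorm_nonneg [simp]: "vnorm n x \<ge> 0" 
  by (simp add: vnorm_def sum_nonneg)

lemma vnorm_sq: "(vnorm n x)\<^sup>2 = (\<Sum>i<n. (x i)\<^sup>2)"
  by (simp add: vnorm_def sum_nonneg)

lemma vnorm_eq_0_iff: "vnorm n x = 0 \<longleftrightarrow> (\<forall>i<n. x i = 0)"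
  by (auto simp: vnorm_def sum_nonneg_eq_0_iff)

text \<open>The square of the inner product is linearised by averaging over an auxiliary Gaussian w.\<close>
lemma cap_upper_aux:
  assumes u: "(\<Sum>i<n. (u i)\<^sup>2) = 1" and x: "0 \<le> x" and kap: "0 \<le> \<kappa>" "\<kappa> * (1 - x\<^sup>2) < 1"
  shows "emeasure (gauss n (\<lambda>_. 0) 1) {g \<in> space (gauss n (\<lambda>_. 0) 1). x * vnorm n g \<le> vinner n u g}
    \<le> ennreal (sqrt ((1 + \<kappa> * x\<^sup>2) / (1 - \<kappa> * (1 - x\<^sup>2))) / sqrt (1 + \<kappa> * x\<^sup>2) ^ n)"
proof -
  define k where "k = 1 + \<kappa> * x\<^sup>2"
  let ?G = "gauss n (\<lambda>_. 0) 1" and ?N = "gauss1 0 1"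
  interpret G: prob_space ?G by (rule prob_space_gauss) simp
  interpret N: prob_space ?N by (rule prob_space_normal_density) simp
  interpret pair_sigma_finite ?N ?G ..
  have k: "k \<ge> 1" using kap by (simp add: k_def)
  then have kpos: "1 + \<kappa> * x\<^sup>2 > 0" by (simp add: k_def)
  have lin: "ennreal (exp ((\<kappa> * t\<^sup>2) / 2)) = (\<integral>\<^sup>+w. ennreal (exp (sqrt \<kappa> * t * w)) \<partial>?N)" for t
    using gauss1_mgf[of 1 1 0 0 "sqrt \<kappa> * t"] kap by (simp add: power_mult_distrib)
  have "emeasure ?G {g \<in> space ?G. x * vnorm n g \<le> vinner n u g}
     \<le> emeasure ?G {g \<in> space ?G. 0 \<le> \<kappa> / 2 * ((vinner n u g)\<^sup>2 - x\<^sup>2 * (vnorm n g)\<^sup>2)}"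
  proof (rule emeasure_mono)
    show "{g \<in> space ?G. x * vnorm n g \<le> vinner n u g} \<subseteq>
       {g \<in> space ?G. 0 \<le> \<kappa> / 2 * ((vinner n u g)\<^sup>2 - x\<^sup>2 * (vnorm n g)\<^sup>2)}"
    proof safe
      fix g assume "x * vnorm n g \<le> vinner n u g"
      then have "(x * vnorm n g)\<^sup>2 \<le> (vinner n u g)\<^sup>2"
        using x by (intro power_mono) auto
      then show "0 \<le> \<kappa> / 2 * ((vinner n u g)\<^sup>2 - x\<^sup>2 * (vnorm n g)\<^sup>2)"
        using kap by (simp add: power_mult_distrib)
    qed
  qed measurable
  also have "\<dots> \<le> (\<integral>\<^sup>+g. ennreal (exp (\<kappa> / 2 * ((vinner n u g)\<^sup>2 - x\<^sup>2 * (vnorm n g)\<^sup>2))) \<partial>?G)"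
    by (rule emeasure_le_nn_integral_exp) measurable
  also have "\<dots> = (\<integral>\<^sup>+g. (\<integral>\<^sup>+w. ennreal (exp (- (\<kappa> * x\<^sup>2 / 2) * (\<Sum>i<n. (g i)\<^sup>2) + (\<Sum>i<n. sqrt \<kappa> * w * u i * g i))) \<partial>?N) \<partial>?G)"
  proof (rule nn_integral_cong)
    fix g
    have "ennreal (exp (\<kappa> / 2 * ((vinner n u g)\<^sup>2 - x\<^sup>2 * (vnorm n g)\<^sup>2)))
      = ennreal (exp (- (\<kappa> * x\<^sup>2 / 2) * (vnorm n g)\<^sup>2)) * ennreal (exp (\<kappa> * (vinner n u g)\<^sup>2 / 2))"
      by (simp add: ennreal_mult[symmetric] exp_add[symmetric] algebra_simps)
    also have "\<dots> = (\<integral>\<^sup>+w. ennreal (exp (- (\<kappa> * x\<^sup>2 / 2) * (vnorm n g)\<^sup>2)) * ennreal (exp (sqrt \<kappa> * vinner n u g * w)) \<partial>?N)"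
      unfolding lin by (subst nn_integral_cmult) auto
    also have "\<dots> = (\<integral>\<^sup>+w. ennreal (exp (- (\<kappa> * x\<^sup>2 / 2) * (\<Sum>i<n. (g i)\<^sup>2) + (\<Sum>i<n. sqrt \<kappa> * w * u i * g i))) \<partial>?N)"
      by (simp add: ennreal_mult[symmetric] exp_add[symmetric] vnorm_sq vinner_def sum_distrib_left mult_ac)
    finally show "ennreal (exp (\<kappa> / 2 * ((vinner n u g)\<^sup>2 - x\<^sup>2 * (vnorm n g)\<^sup>2))) = \<dots>" .
  qed
  also have "\<dots> = (\<integral>\<^sup>+w. (\<integral>\<^sup>+g. ennreal (exp (- (\<kappa> * x\<^sup>2 / 2) * (\<Sum>i<n. (g i)\<^sup>2) + (\<Sum>i<n. sqrt \<kappa> * w * u i * g i))) \<partial>?G) \<partial>?N)"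
    by (rule Fubini') measurable
  also have "\<dots> = (\<integral>\<^sup>+w. ennreal (exp (\<kappa> * w\<^sup>2 / (2 * k)) / sqrt k ^ n) \<partial>?N)"
  proof (rule nn_integral_cong)
    fix w
    show "(\<integral>\<^sup>+g. ennreal (exp (- (\<kappa> * x\<^sup>2 / 2) * (\<Sum>i<n. (g i)\<^sup>2) + (\<Sum>i<n. sqrt \<kappa> * w * u i * g i))) \<partial>?G)
       = ennreal (exp (\<kappa> * w\<^sup>2 / (2 * k)) / sqrt k ^ n)"
      using gauss_mgf[of 1 k "- (\<kappa> * x\<^sup>2 / 2)" n "\<lambda>_. 0" "\<lambda>i. sqrt \<kappa> * w * u i"] k kap kpos
      by (simp add: k_def power_mult_distrib sum_distrib_left[symmetric] u)
  qed
  also have "\<dots> = (\<integral>\<^sup>+w. ennreal (1 / sqrt k ^ n) * ennreal (exp (\<kappa> * w\<^sup>2 / (2 * k))) \<partial>?N)"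
    using k by (simp add: ennreal_mult[symmetric])
  also have "\<dots> = ennreal (1 / sqrt k ^ n) * (\<integral>\<^sup>+w. ennreal (exp (\<kappa> * w\<^sup>2 / (2 * k))) \<partial>?N)"
    by (rule nn_integral_cmult) measurable
  \<comment> \<open>The integral over w converges exactly when \<kappa> < k, which is the hypothesis
    on \<kappa> (1 - x^2).\<close>
  also have "(\<integral>\<^sup>+w. ennreal (exp (\<kappa> * w\<^sup>2 / (2 * k))) \<partial>?N) = ennreal (1 / sqrt (1 - \<kappa> / k))"
    using gauss1_mgf[of 1 "1 - \<kappa> / k" "\<kappa> / (2 * k)" 0 0] k kap
    by (simp add: k_def field_simps)
  also have "1 - \<kappa> / k = (1 - \<kappa> * (1 - x\<^sup>2)) / k"
    using k by (simp add: field_simps) (simp add: k_def algebra_simps)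
  also have "ennreal (1 / sqrt k ^ n) * ennreal (1 / sqrt ((1 - \<kappa> * (1 - x\<^sup>2)) / k))
     = ennreal (sqrt (k / (1 - \<kappa> * (1 - x\<^sup>2))) / sqrt k ^ n)"
    using k kap by (simp add: ennreal_mult[symmetric] real_sqrt_divide)
  finally show ?thesis by (simp add: k_def)
qed

section \<open>Averaging over the competing codeword\<close>

text \<open>The parameter m only has to dominate 1 - x^2, which keeps it positive even when x
  reaches 1 and lets an exponential of the noise be inserted for it. The auxiliary bound decays like
  k^(-(n-1)/2) with k \<ge> \<kappa>, so \<kappa> should be close to 1 / m.\<close>

lemma cap_upper:
  assumes n: "n \<ge> 2" and u: "(\<Sum>i<n. (u i)\<^sup>2) = 1" and x: "0 \<le> x" and m: "1 - x\<^sup>2 \<le> m" "m > 0"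
  shows "emeasure (gauss n (\<lambda>_. 0) 1) {g \<in> space (gauss n (\<lambda>_. 0) 1). x * vnorm n g \<le> vinner n u g}
    \<le> ennreal (2 * sqrt (real n) * m powr ((real n - 1) / 2))"
proof (cases "m \<le> 1")
  case False
  interpret G: prob_space "gauss n (\<lambda>_. 0) 1" by (rule prob_space_gauss) simp
  have "1 \<le> m powr ((real n - 1) / 2)"
    using False n by (intro ge_one_powr_ge_zero) auto
  moreover have "1 \<le> sqrt (real n)" using n by simp
  ultimately have "1 * 1 \<le> sqrt (real n) * m powr ((real n - 1) / 2)"
    by (intro mult_mono) auto
  then have "(1::ennreal) \<le> ennreal (2 * sqrt (real n) * m powr ((real n - 1) / 2))"
    by (subst ennreal_1[symmetric], intro ennreal_leI) linarith
  then show ?thesis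
    by (rule order_trans[OF G.emeasure_le_1])
next
  case True
  \<comment> \<open>Stopping a relative 1/n short of 1/m keeps the denominator 1 - \<kappa> (1 -
    x^2) above 1/n. The price is the factor sqrt n, and (1 - 1/n)^(-(n-1)/2) \<le> sqrt e \<le>
    2.\<close>
  define \<kappa> where "\<kappa> = (1 - 1 / real n) / m"
  have \<kappa>: "\<kappa> > 0" using n m by (simp add: \<kappa>_def)
  have \<kappa>m: "\<kappa> * m = 1 - 1 / real n" using m by (simp add: \<kappa>_def)
  have "\<kappa> * (1 - x\<^sup>2) \<le> \<kappa> * m" using \<kappa> m by simp
  then have lt: "1 - \<kappa> * (1 - x\<^sup>2) \<ge> 1 / real n" using \<kappa>m by simp
  have npos: "1 / real n > 0" using n by simp
  define k where "k = 1 + \<kappa> * x\<^sup>2"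
  have "k \<ge> 1 + \<kappa> * (1 - m)" using \<kappa> m by (simp add: k_def)
  then have k\<kappa>: "k \<ge> \<kappa>" using \<kappa>m npos by (simp only: right_diff_distrib)
  have k1: "k \<ge> 1" using \<kappa> by (simp add: k_def)
  have p1: "sqrt k ^ (n - 1) = k powr ((real n - 1) / 2)"
    using k1 n by (simp add: powr_half_sqrt[symmetric] powr_realpow[symmetric] powr_powr of_nat_diff)
  have nn: "1 - 1 / real n = inverse (1 + 1 / (real n - 1))"
    using n by (simp add: field_simps)
  have \<kappa>1: "\<kappa> powr (- ((real n - 1) / 2)) = m powr ((real n - 1) / 2) * (1 + 1 / (real n - 1)) powr ((real n - 1) / 2)"
    using m n unfolding \<kappa>_def nn
    by (simp add: powr_minus powr_divide inverse_powr[symmetric] powr_mult field_simps)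
  have "(1 + 1 / (real n - 1)) powr ((real n - 1) / 2) \<le> exp (1 / (real n - 1)) powr ((real n - 1) / 2)"
    using n by (intro powr_mono2 exp_ge_add_one_self) auto
  also have "\<dots> = exp (1/2)" using n by (simp add: exp_powr_real)
  also have "\<dots> \<le> (2::real)"
  proof -
    have "exp (1/2) ^ 2 = exp (1::real)" by (simp add: exp_of_nat_mult[symmetric])
    also have "\<dots> \<le> 2 ^ 2" using exp_le by simp
    finally show ?thesis by (rule power2_le_imp_le) simp
  qed
  finally have "m powr ((real n - 1) / 2) * (1 + 1 / (real n - 1)) powr ((real n - 1) / 2) \<le> m powr ((real n - 1) / 2) * 2"
    by (intro mult_left_mono) auto
  then have \<kappa>p: "\<kappa> powr (- ((real n - 1) / 2)) \<le> 2 * m powr ((real n - 1) / 2)"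
    unfolding \<kappa>1 by simp
  have lt1: "\<kappa> * (1 - x\<^sup>2) < 1" using lt npos by linarith
  have "sqrt (k / (1 - \<kappa> * (1 - x\<^sup>2))) \<le> sqrt (k / (1 / real n))"
    by (intro real_sqrt_le_mono divide_left_mono[OF lt] mult_pos_pos npos) (use k1 lt1 in linarith)+
  also have "\<dots> = sqrt k * sqrt (real n)" by (simp add: real_sqrt_mult)
  finally have "sqrt (k / (1 - \<kappa> * (1 - x\<^sup>2))) / sqrt k ^ n \<le> sqrt k * sqrt (real n) / sqrt k ^ n"
    using k1 by (intro divide_right_mono) auto
  also have "\<dots> = sqrt (real n) / sqrt k ^ (n - 1)"
    using k1 n by (cases n) auto
  also have "\<dots> = sqrt (real n) * k powr (- ((real n - 1) / 2))"
    unfolding p1 by (simp only: powr_minus divide_inverse)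
  also have "\<dots> \<le> sqrt (real n) * (2 * m powr ((real n - 1) / 2))"
  proof (rule mult_left_mono)
    have "k powr (- ((real n - 1) / 2)) \<le> \<kappa> powr (- ((real n - 1) / 2))"
      using k\<kappa> \<kappa> n by (intro powr_mono2') auto
    also note \<kappa>p
    finally show "k powr (- ((real n - 1) / 2)) \<le> 2 * m powr ((real n - 1) / 2)" .
  qed simp
  finally have *: "sqrt (k / (1 - \<kappa> * (1 - x\<^sup>2))) / sqrt k ^ n \<le> 2 * sqrt (real n) * m powr ((real n - 1) / 2)"
    by (simp add: mult_ac)
  from cap_upper_aux[OF u x less_imp_le[OF \<kappa>] lt1]
  show ?thesis using * unfolding k_def[symmetric] by (meson ennreal_leI order_trans)
qed

section \<open>Spherical codewords and the pairwise error event\<close>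

lemma sets_sphere_unif [measurable_cong, simp]:
  "sets (sphere_unif n P) = sets (PiM {..<n} (\<lambda>_. borel))"
  unfolding sphere_unif_def sets_distr by (intro sets_PiM_cong) auto

lemma normalise_measurable:
  "(\<lambda>x. \<lambda>i\<in>{..<n}. sqrt (real n * P) * x i / vnorm n x) \<in> measurable (gauss n \<mu> \<sigma>) (PiM {..<n} (\<lambda>_. lborel))"
  by (rule measurable_restrict) measurable

lemma prob_space_sphere_unif: "prob_space (sphere_unif n P)"
  unfolding sphere_unif_def gauss_vec_eq
  by (intro prob_space.prob_space_distr prob_space_gauss normalise_measurable) auto

text \<open>Written as an integral of an indicator, the error probability becomes accessible to
  Tonelli and is seen to be measurable in both codewords.\<close>

lemma pair_err_eq:
  assumes "\<sigma> > 0"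
  shows "ennreal (pair_err n \<sigma> th c ce) = (\<integral>\<^sup>+z. indicator {z. vnorm n (\<lambda>i. c i + z i - ce i) \<le> vnorm n z
      \<and> (\<lambda>i. c i + z i) \<in> cone n c th} z \<partial>gauss n (\<lambda>_. 0) \<sigma>)"
proof -
  interpret N: prob_space "gauss n (\<lambda>_. 0) \<sigma>" by (rule prob_space_gauss) fact
  let ?A = "{z \<in> space (gauss n (\<lambda>_. 0) \<sigma>). vnorm n (\<lambda>i. c i + z i - ce i) \<le> vnorm n z
      \<and> (\<lambda>i. c i + z i) \<in> cone n c th}"
  have "?A \<in> sets (gauss n (\<lambda>_. 0) \<sigma>)"
    unfolding cone_def mem_Collect_eq vinner_def vnorm_def by measurable
  then have "ennreal (pair_err n \<sigma> th c ce) = (\<integral>\<^sup>+z. indicator ?A z \<partial>gauss n (\<lambda>_. 0) \<sigma>)"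
    unfolding pair_err_def gauss_vec_eq by (simp add: N.emeasure_eq_measure)
  also have "\<dots> = (\<integral>\<^sup>+z. indicator {z. vnorm n (\<lambda>i. c i + z i - ce i) \<le> vnorm n z
      \<and> (\<lambda>i. c i + z i) \<in> cone n c th} z \<partial>gauss n (\<lambda>_. 0) \<sigma>)"
    by (intro nn_integral_cong) (auto simp: indicator_def)
  finally show ?thesis .
qed

lemma measurable_ennreal_pair_err:
  assumes s: "\<sigma> > 0" and [measurable]: "\<And>i. i < n \<Longrightarrow> (\<lambda>w. f w i) \<in> borel_measurable M"
    "\<And>i. i < n \<Longrightarrow> (\<lambda>w. g w i) \<in> borel_measurable M"
  shows "(\<lambda>w. ennreal (pair_err n \<sigma> th (f w) (g w))) \<in> borel_measurable M"
proof -
  interpret N: prob_space "gauss n (\<lambda>_. 0) \<sigma>" by (rule prob_space_gauss) fact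
  show ?thesis
    unfolding pair_err_eq[OF s] cone_def mem_Collect_eq indicator_def vinner_def vnorm_def by measurable
qed

text \<open>One coordinate suffices to certify that a Gaussian vector, or a Gaussian vector plus a
  codeword, is almost surely nonzero; normalisation and angles need this because division by 0
  yields 0.\<close>

lemma AE_gauss_neq:
  assumes s: "\<sigma> > 0" and n: "n > 0"
  shows "AE z in gauss n \<mu> \<sigma>. z 0 \<noteq> t"
proof -
  have "AE x in lborel. x \<noteq> t" by (rule AE_lborel_singleton)
  then have "AE x in gauss1 (\<mu> 0) \<sigma>. x \<noteq> t"
    by (subst AE_density) auto
  then show ?thesis
    unfolding gauss_def using n s
    by (intro AE_PiM_component[where P="\<lambda>x. x \<noteq> t"] prob_space_normal_density) auto
qed

lemma dist_le_iff:
  assumes "vnorm n c = vnorm n ce"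
  shows "vnorm n (\<lambda>i. c i + z i - ce i) \<le> vnorm n z \<longleftrightarrow>
    vinner n (\<lambda>i. c i + z i) c \<le> vinner n (\<lambda>i. c i + z i) ce"
proof -
  have "vnorm n (\<lambda>i. c i + z i - ce i) \<le> vnorm n z \<longleftrightarrow>
    (vnorm n (\<lambda>i. c i + z i - ce i))\<^sup>2 \<le> (vnorm n z)\<^sup>2"
    by (simp add: abs_le_square_iff[symmetric])
  also have "(vnorm n (\<lambda>i. c i + z i - ce i))\<^sup>2 = (vnorm n z)\<^sup>2 + (vnorm n ce)\<^sup>2 - (vnorm n c)\<^sup>2
     + 2 * vinner n (\<lambda>i. c i + z i) c - 2 * vinner n (\<lambda>i. c i + z i) ce"
    unfolding vnorm_sq vinner_def sum_distrib_left sum.distrib[symmetric] sum_subtractf[symmetric]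
    by (intro sum.cong) (auto simp: power2_eq_square algebra_simps)
  finally show ?thesis using assms by simp
qed

text \<open>For codewords of equal norm the distance comparison is a comparison of correlations with
  y = c + z. The competitor is a normalised Gaussian g, so multiplying by |g| removes the quotient;
  Tonelli then puts the noise outside and leaves a cap probability in g with y fixed.\<close>

lemma pair_err_average:
  assumes s: "\<sigma> > 0" and P: "P > 0" and n: "n > 0" and c: "vnorm n c = sqrt (real n * P)"
  shows "(\<integral>\<^sup>+ce. ennreal (pair_err n \<sigma> th c ce) \<partial>sphere_unif n P) =
    (\<integral>\<^sup>+z. (if (\<lambda>i. c i + z i) \<in> cone n c th then
       emeasure (gauss n (\<lambda>_. 0) 1) {g \<in> space (gauss n (\<lambda>_. 0) 1).
         vinner n (\<lambda>i. c i + z i) c * vnorm n g \<le> sqrt (real n * P) * vinner n (\<lambda>i. c i + z i) g}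
       else 0) \<partial>gauss n (\<lambda>_. 0) \<sigma>)"
proof -
  let ?G = "gauss n (\<lambda>_. 0) 1" and ?N = "gauss n (\<lambda>_. 0) \<sigma>"
  interpret G: prob_space ?G by (rule prob_space_gauss) simp
  interpret N: prob_space ?N by (rule prob_space_gauss) fact
  interpret pair_sigma_finite ?N ?G ..
  let ?T = "\<lambda>x. \<lambda>i\<in>{..<n}. sqrt (real n * P) * x i / vnorm n x"
  let ?y = "\<lambda>z i. c i + z i"
  have "(\<integral>\<^sup>+ce. ennreal (pair_err n \<sigma> th c ce) \<partial>sphere_unif n P)
     = (\<integral>\<^sup>+g. ennreal (pair_err n \<sigma> th c (?T g)) \<partial>?G)"
    unfolding sphere_unif_def gauss_vec_eq
    by (rule nn_integral_distr[OF normalise_measurable]) (rule measurable_ennreal_pair_err[OF s]; simp; measurable)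
  also have "\<dots> = (\<integral>\<^sup>+g. (\<integral>\<^sup>+z. (if vinner n (?y z) c * vnorm n g \<le> sqrt (real n * P) * vinner n (?y z) g
       \<and> ?y z \<in> cone n c th then 1 else 0) \<partial>?N) \<partial>?G)"
  proof (rule nn_integral_cong_AE)
    have "AE g in ?G. g 0 \<noteq> 0" by (rule AE_gauss_neq) (use n in auto)
    then show "AE g in ?G. ennreal (pair_err n \<sigma> th c (?T g)) =
      (\<integral>\<^sup>+z. (if vinner n (?y z) c * vnorm n g \<le> sqrt (real n * P) * vinner n (?y z) g
       \<and> ?y z \<in> cone n c th then 1 else 0) \<partial>?N)"
    proof eventually_elim
      case (elim g)
      then have "vnorm n g \<noteq> 0" using n by (auto simp: vnorm_eq_0_iff)
      then have g: "vnorm n g > 0" using vnorm_nonneg[of n g] by linarith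
      have "(vnorm n (?T g))\<^sup>2 = (\<Sum>i<n. (real n * P / (vnorm n g)\<^sup>2) * (g i)\<^sup>2)"
        unfolding vnorm_sq using P by (intro sum.cong) (auto simp: power_divide power_mult_distrib vnorm_sq)
      also have "\<dots> = (vnorm n c)\<^sup>2"
        unfolding sum_distrib_left[symmetric] vnorm_sq[symmetric] c using g P by simp
      finally have eq: "vnorm n c = vnorm n (?T g)" by simp
      have inner: "vinner n y (?T g) = sqrt (real n * P) * vinner n y g / vnorm n g" for y
        unfolding vinner_def sum_distrib_left sum_divide_distrib by (intro sum.cong) auto
      show ?case
        unfolding pair_err_eq[OF s] dist_le_iff[OF eq] inner pos_le_divide_eq[OF g]
        by (intro nn_integral_cong) (simp add: indicator_def)
    qed
  qed
  also have "\<dots> = (\<integral>\<^sup>+z. (\<integral>\<^sup>+g. (if vinner n (?y z) c * vnorm n g \<le> sqrt (real n * P) * vinner n (?y z) g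
       \<and> ?y z \<in> cone n c th then 1 else 0) \<partial>?G) \<partial>?N)"
  proof (rule Fubini')
    have [measurable]: "(\<lambda>p. vinner n (?y (fst p)) c) \<in> borel_measurable (?N \<Otimes>\<^sub>M ?G)"
      unfolding vinner_def by measurable
    have [measurable]: "(\<lambda>p. vinner n (?y (fst p)) (snd p)) \<in> borel_measurable (?N \<Otimes>\<^sub>M ?G)"
      unfolding vinner_def by measurable
    have [measurable]: "(\<lambda>p. vnorm n (?y (fst p))) \<in> borel_measurable (?N \<Otimes>\<^sub>M ?G)"
      unfolding vnorm_def by measurable
    have [measurable]: "(\<lambda>p. vnorm n (snd p)) \<in> borel_measurable (?N \<Otimes>\<^sub>M ?G)"
      unfolding vnorm_def by measurable
    show "(\<lambda>(z, g). if vinner n (?y z) c * vnorm n g \<le> sqrt (real n * P) * vinner n (?y z) g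
       \<and> ?y z \<in> cone n c th then 1 else 0 :: ennreal) \<in> borel_measurable (?N \<Otimes>\<^sub>M ?G)"
      unfolding cone_def mem_Collect_eq case_prod_beta' by measurable
  qed
  also have "\<dots> = (\<integral>\<^sup>+z. (if ?y z \<in> cone n c th then
       emeasure ?G {g \<in> space ?G. vinner n (?y z) c * vnorm n g \<le> sqrt (real n * P) * vinner n (?y z) g}
       else 0) \<partial>?N)"
  proof (rule nn_integral_cong)
    fix z
    let ?S = "{g \<in> space ?G. vinner n (?y z) c * vnorm n g \<le> sqrt (real n * P) * vinner n (?y z) g}"
    have "?S \<in> sets ?G" by measurable
    then have "emeasure ?G ?S = (\<integral>\<^sup>+g. indicator ?S g \<partial>?G)" by simp
    also have "\<dots> = (\<integral>\<^sup>+g. (if vinner n (?y z) c * vnorm n g \<le> sqrt (real n * P) * vinner n (?y z) g then 1 else 0) \<partial>?G)"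
      by (intro nn_integral_cong) (auto simp: indicator_def)
    finally show "(\<integral>\<^sup>+g. (if vinner n (?y z) c * vnorm n g \<le> sqrt (real n * P) * vinner n (?y z) g
       \<and> ?y z \<in> cone n c th then 1 else 0) \<partial>?G) = (if ?y z \<in> cone n c th then emeasure ?G ?S else 0)"
      by simp
  qed
  finally show ?thesis .
qed

section \<open>The Gallager exponent\<close>

text \<open>The excess over |c|^2 sin^2 \<phi> is a perfect square in s. Hence every s gives an
  upper bound for the sine, and a fixed s makes it quadratic in the noise.\<close>

lemma vnorm_diff_scaled_sq:
  assumes "vinner n y c = x * vnorm n y * vnorm n c"
  shows "(\<Sum>i<n. (c i - s * y i)\<^sup>2) = (s * vnorm n y - vnorm n c * x)\<^sup>2 + (vnorm n c)\<^sup>2 * (1 - x\<^sup>2)"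
proof -
  have "(\<Sum>i<n. (c i - s * y i)\<^sup>2) = (vnorm n c)\<^sup>2 - 2 * s * vinner n y c + s\<^sup>2 * (vnorm n y)\<^sup>2"
    unfolding vnorm_sq vinner_def sum_distrib_left sum.distrib[symmetric] sum_subtractf[symmetric]
    by (intro sum.cong) (auto simp: power2_eq_square algebra_simps)
  then show ?thesis
    unfolding assms by (simp add: power2_eq_square algebra_simps)
qed

text \<open>For \<open>r = 1\<close> this is the tangent bound X \<le> exp (X - 1). For r < 1 the
  bound w \<le> exp (r (w - 1)) breaks down just above w = 1, hence the second alternative; when X
  \<ge> 1 \<ge> w the right-hand side is at least 1 anyway. With r = \<rho> this is the point at
  which the cone enters the upper bound.\<close>

lemma scaled_exp_ge:
  fixes r w X :: real
  assumes r: "0 \<le> r" "r \<le> 1" and w: "w \<le> X" "r = 1 \<or> w \<le> 1"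
  shows "w \<le> exp (r * (X - 1))"
proof (cases "X \<ge> 1 \<and> w \<le> 1")
  case True
  then have "1 \<le> exp (r * (X - 1))" using r by simp
  with True show ?thesis by linarith
next
  case False
  have "r * (X - 1) \<ge> X - 1"
  proof (cases "r = 1")
    case F: False
    then have "X < 1" using False w by auto
    then show ?thesis using mult_right_mono_neg[OF r(2), of "X - 1"] by simp
  qed simp
  then have "1 + (X - 1) \<le> exp (r * (X - 1))"
    using exp_ge_add_one_self[of "r * (X - 1)"] by linarith
  then show ?thesis using w by linarith
qed

text \<open>Here \<open>q\<close> is 1 + \<rho>. The equation \<open>stationary\<close> is the
  vanishing of the derivative of E_G in \<beta> with \<rho> fixed, cleared of denominators; for
  \<beta> = e^(2R) it is also the vanishing of the derivative in \<rho>. This lets one locale serve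
  both rate regimes.\<close>

locale gallager =
  fixes P \<sigma> \<beta> q :: real
  assumes P: "P > 0" and sig: "\<sigma> > 0" and \<beta>: "\<beta> > 1" and q: "q \<ge> 1"
    and stationary: "(\<beta> - 1) * q * (\<beta> * q - P / \<sigma>\<^sup>2) = P / \<sigma>\<^sup>2"
begin

definition snr where "snr = P / \<sigma>\<^sup>2"
text \<open>The argument of the logarithm in E_G; the tilted noise has variance \<sigma>^2 /
  D.\<close>

definition D where "D = \<beta> - snr / q"
definition s where "s = snr / (\<beta> * q)"
text \<open>E_G without its rate term: E_G = E1 + \<rho> (ln \<beta> / 2 - R).\<close>

definition E1 where "E1 = ((1 - \<beta>) * q + snr + ln D) / 2"

text \<open>X is \<beta> |c - s y|^2 / |c|^2 for y = c + z, an upper bound for \<beta> sin^2 of the angle between c and y.\<close>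
definition X where "X n c z = (\<Sum>i<n. ((1 - s) * c i - s * z i)\<^sup>2) * \<beta> / (real n * P)"

lemma snr_pos: "snr > 0" using P sig by (simp add: snr_def)

lemma qD: "q * D = \<beta> * q - snr" using q by (simp add: D_def field_simps)

lemma snr_eq: "snr = (\<beta> - 1) * q\<^sup>2 * D"
  using stationary unfolding snr_def[symmetric] qD[symmetric] by (simp add: power2_eq_square mult_ac)

lemma D_pos: "D > 0"
proof (rule zero_less_mult_pos)
  show "0 < (\<beta> - 1) * q\<^sup>2 * D" using snr_pos unfolding snr_eq .
qed (use \<beta> q in auto)

text \<open>This is 1 / D = q - (q - 1) / \<beta>, the stationarity condition in \<beta> in its
  natural form.\<close>

lemma D_eq: "D * (q * \<beta> - q + 1) = \<beta>"
proof -
  have "q * (D * (q * \<beta> - q + 1)) = (\<beta> - 1) * q\<^sup>2 * D + q * D"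
    by (simp add: algebra_simps power2_eq_square)
  also have "\<dots> = q * \<beta>" unfolding snr_eq[symmetric] qD by simp
  finally show ?thesis using q by simp
qed

lemma D_eq2: "(q - 1) * D / \<beta> = q * D - 1"
proof -
  have "(q - 1) * D = \<beta> * (q * D - 1)" using D_eq by (simp add: algebra_simps)
  then show ?thesis using \<beta> by (simp add: field_simps)
qed

lemma one_minus_s: "1 - s = D / \<beta>"
  using \<beta> q by (simp add: s_def D_def field_simps)

lemma s_pos: "s > 0" using snr_pos \<beta> q by (simp add: s_def)

text \<open>The left-hand side is 2 \<sigma>^2 times the coefficient of |z|^2 in the moment of
  \<open>X\<close>, so \<open>D\<close> is the factor k of \<open>gauss_mgf\<close>.\<close>

lemma one_minus_D: "(q - 1) * \<beta> * s\<^sup>2 / snr = 1 - D"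
proof -
  have *: "(q - 1) * (\<beta> - 1) * D = \<beta> * (1 - D)" using D_eq by (simp add: algebra_simps)
  have "(q - 1) * \<beta> * s\<^sup>2 / snr = (q - 1) * snr / (\<beta> * q\<^sup>2)"
    unfolding s_def using \<beta> q snr_pos by (simp add: field_simps power2_eq_square)
  also have "\<dots> = (q - 1) * (\<beta> - 1) * D / \<beta>"
    unfolding snr_eq using \<beta> q by (simp add: field_simps)
  also have "\<dots> = 1 - D" unfolding * using \<beta> by simp
  finally show ?thesis .
qed

lemma X_nonneg: "X n c z \<ge> 0"
  unfolding X_def using P \<beta> by (intro divide_nonneg_nonneg mult_nonneg_nonneg sum_nonneg) auto

text \<open>The exponent is quadratic in z, so the moment is exact. Apart from the factor D^(-n/2),
  stationarity in the form \<open>D_eq2\<close> turns the constant into -n/2 ((1 - \<beta>) q +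
  snr).\<close>

lemma mgf_X:
  assumes n: "n > 0" and c: "vnorm n c = sqrt (real n * P)"
  shows "(\<integral>\<^sup>+z. ennreal (exp ((q - 1) * (real n / 2) * (X n c z - 1))) \<partial>gauss n (\<lambda>_. 0) \<sigma>)
    = ennreal (exp (- real n * E1))"
proof -
  \<comment> \<open>The weight for which (q - 1) (n/2) X equals a times the squared norm of (1 - s)
    c - s z.\<close>
  define a where "a = (q - 1) * \<beta> / (2 * P)"
  define K where "K = a * (1 - s)\<^sup>2 * (real n * P) - (q - 1) * real n / 2"
  have c2: "(\<Sum>i<n. (c i)\<^sup>2) = real n * P"
    unfolding vnorm_sq[symmetric] c using P by simp
  have ex: "(q - 1) * (real n / 2) * (X n c z - 1)
     = K + (a * s\<^sup>2 * (\<Sum>i<n. (z i - 0)\<^sup>2) + (\<Sum>i<n. (- (2 * a * s * (1 - s)) * c i) * (z i - 0)))" for z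
  proof -
    have "(\<Sum>i<n. ((1 - s) * c i - s * z i)\<^sup>2) = (1 - s)\<^sup>2 * (\<Sum>i<n. (c i)\<^sup>2) + s\<^sup>2 * (\<Sum>i<n. (z i)\<^sup>2)
       - 2 * s * (1 - s) * (\<Sum>i<n. c i * z i)"
      unfolding sum_distrib_left sum.distrib[symmetric] sum_subtractf[symmetric]
      by (intro sum.cong) (auto simp: power2_eq_square algebra_simps)
    moreover have "(q - 1) * (real n / 2) * (X n c z - 1) = a * (\<Sum>i<n. ((1 - s) * c i - s * z i)\<^sup>2) - (q - 1) * real n / 2"
      using n P unfolding X_def a_def by (simp add: field_simps)
    ultimately have "(q - 1) * (real n / 2) * (X n c z - 1) = a * ((1 - s)\<^sup>2 * (real n * P) + s\<^sup>2 * (\<Sum>i<n. (z i)\<^sup>2)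
       - 2 * s * (1 - s) * (\<Sum>i<n. c i * z i)) - (q - 1) * real n / 2"
      unfolding c2 by simp
    then show ?thesis
      unfolding K_def mult.assoc sum_distrib_left[symmetric] diff_0_right
      by (simp add: algebra_simps)
  qed
  have k: "D = 1 - 2 * (a * s\<^sup>2) * \<sigma>\<^sup>2"
    using one_minus_D P sig unfolding a_def snr_def by (simp add: field_simps)
  have "(\<integral>\<^sup>+z. ennreal (exp ((q - 1) * (real n / 2) * (X n c z - 1))) \<partial>gauss n (\<lambda>_. 0) \<sigma>)
     = (\<integral>\<^sup>+z. ennreal (exp K) * ennreal (exp (a * s\<^sup>2 * (\<Sum>i<n. (z i - 0)\<^sup>2) + (\<Sum>i<n. (- (2 * a * s * (1 - s)) * c i) * (z i - 0)))) \<partial>gauss n (\<lambda>_. 0) \<sigma>)"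
    unfolding ex exp_add[of K] by (simp add: ennreal_mult)
  also have "\<dots> = ennreal (exp K) * ennreal (exp ((\<Sum>i<n. (- (2 * a * s * (1 - s)) * c i)\<^sup>2) * \<sigma>\<^sup>2 / (2 * D)) / sqrt D ^ n)"
    by (subst nn_integral_cmult) (measurable, subst gauss_mgf[OF sig k D_pos], simp)
  also have "\<dots> = ennreal (exp (- real n * E1))"
  proof -
    have "(\<Sum>i<n. (- (2 * a * s * (1 - s)) * c i)\<^sup>2) * \<sigma>\<^sup>2 / (2 * D)
       = (2 * a * s\<^sup>2 * \<sigma>\<^sup>2) * (a * (1 - s)\<^sup>2 * (real n * P)) / D"
      unfolding power_mult_distrib sum_distrib_left[symmetric] c2
      by (simp add: power2_eq_square)
    also have "2 * a * s\<^sup>2 * \<sigma>\<^sup>2 = 1 - D" using k by simp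
    finally have Q: "(\<Sum>i<n. (- (2 * a * s * (1 - s)) * c i)\<^sup>2) * \<sigma>\<^sup>2 / (2 * D)
       = (1 - D) * (a * (1 - s)\<^sup>2 * (real n * P)) / D" .
    have "K + (\<Sum>i<n. (- (2 * a * s * (1 - s)) * c i)\<^sup>2) * \<sigma>\<^sup>2 / (2 * D)
       = a * (1 - s)\<^sup>2 * (real n * P) / D - (q - 1) * real n / 2"
      unfolding Q K_def using D_pos by (simp add: field_simps)
    also have "\<dots> = real n / 2 * ((q - 1) * D / \<beta> - (q - 1))"
      unfolding one_minus_s a_def using P \<beta> D_pos by (simp add: field_simps power2_eq_square)
    also have "\<dots> = - real n / 2 * ((1 - \<beta>) * q + snr)"
      unfolding D_eq2 qD by (simp add: algebra_simps)
    finally have 1: "K + (\<Sum>i<n. (- (2 * a * s * (1 - s)) * c i)\<^sup>2) * \<sigma>\<^sup>2 / (2 * D)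
       = - real n / 2 * ((1 - \<beta>) * q + snr)" .
    have 2: "sqrt D ^ n = exp (real n * (ln D / 2))"
      using D_pos unfolding exp_of_nat_mult by (simp add: powr_half_sqrt[symmetric] powr_def)
    have "exp K * (exp ((\<Sum>i<n. (- (2 * a * s * (1 - s)) * c i)\<^sup>2) * \<sigma>\<^sup>2 / (2 * D)) / sqrt D ^ n)
       = exp (K + (\<Sum>i<n. (- (2 * a * s * (1 - s)) * c i)\<^sup>2) * \<sigma>\<^sup>2 / (2 * D) - real n * (ln D / 2))"
      unfolding 2 exp_add exp_diff by simp
    also have "\<dots> = exp (- real n * E1)" unfolding 1 E1_def by (simp add: field_simps)
    finally show ?thesis using D_pos by (subst ennreal_mult[symmetric]) auto
  qed
  finally show ?thesis .
qed

lemma X_ge: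
  assumes n: "n > 0" and c: "vnorm n c = sqrt (real n * P)"
    and x: "vinner n (\<lambda>i. c i + z i) c = x * vnorm n (\<lambda>i. c i + z i) * vnorm n c"
  shows "\<beta> * (1 - x\<^sup>2) \<le> X n c z"
proof -
  have c2: "(vnorm n c)\<^sup>2 = real n * P" unfolding c using P by simp
  have "real n * P * (1 - x\<^sup>2) \<le> (\<Sum>i<n. (c i - s * (c i + z i))\<^sup>2)"
    unfolding vnorm_diff_scaled_sq[OF x] c2 by simp
  also have "\<dots> = (\<Sum>i<n. ((1 - s) * c i - s * z i)\<^sup>2)"
    by (intro sum.cong) (auto simp: algebra_simps)
  finally have "real n * P * (1 - x\<^sup>2) * \<beta> \<le> (\<Sum>i<n. ((1 - s) * c i - s * z i)\<^sup>2) * \<beta>"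
    using \<beta> by (intro mult_right_mono) auto
  then show ?thesis
    unfolding X_def using n P by (simp add: field_simps)
qed

text \<open>Beyond a right angle the sine decreases again, so \<open>X_ge\<close> cannot be quoted.
  Instead s > 0 makes |c - s y|^2 decreasing in the inner product of y and c, which is below its
  value at angle th for y outside the cone.\<close>

lemma X_ge_outside_cone:
  assumes n: "n > 0" and c: "vnorm n c = sqrt (real n * P)" and th: "cos th \<ge> 0"
    and x: "(\<lambda>i. c i + z i) \<notin> cone n c th"
  shows "\<beta> * (sin th)\<^sup>2 \<le> X n c z"
proof -
  let ?y = "\<lambda>i. c i + z i"
  have c2: "(vnorm n c)\<^sup>2 = real n * P" unfolding c using P by simp
  have sq: "(\<Sum>i<n. (c i - s * ?y i)\<^sup>2) = (vnorm n c)\<^sup>2 - 2 * s * vinner n ?y c + s\<^sup>2 * (vnorm n ?y)\<^sup>2"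
    unfolding vnorm_sq vinner_def sum_distrib_left sum.distrib[symmetric] sum_subtractf[symmetric]
    by (intro sum.cong) (auto simp: power2_eq_square algebra_simps)
  have "s * vinner n ?y c \<le> s * (vnorm n ?y * vnorm n c * cos th)"
    using x s_pos by (intro mult_left_mono) (auto simp: cone_def)
  then have "(vnorm n c)\<^sup>2 - 2 * (s * (vnorm n ?y * vnorm n c * cos th)) + s\<^sup>2 * (vnorm n ?y)\<^sup>2 \<le> (\<Sum>i<n. (c i - s * ?y i)\<^sup>2)"
    unfolding sq by simp
  moreover have "(vnorm n c)\<^sup>2 - 2 * (s * (vnorm n ?y * vnorm n c * cos th)) + s\<^sup>2 * (vnorm n ?y)\<^sup>2
     = (s * vnorm n ?y - vnorm n c * cos th)\<^sup>2 + (vnorm n c)\<^sup>2 * (sin th)\<^sup>2"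
    unfolding sin_squared_eq by (simp add: power2_eq_square algebra_simps)
  ultimately have "(vnorm n c)\<^sup>2 * (sin th)\<^sup>2 \<le> (\<Sum>i<n. (c i - s * ?y i)\<^sup>2)"
    using zero_le_power2[of "s * vnorm n ?y - vnorm n c * cos th"] by linarith
  also have "(\<Sum>i<n. (c i - s * ?y i)\<^sup>2) = (\<Sum>i<n. ((1 - s) * c i - s * z i)\<^sup>2)"
    by (intro sum.cong) (auto simp: algebra_simps)
  finally have "real n * P * (sin th)\<^sup>2 * \<beta> \<le> (\<Sum>i<n. ((1 - s) * c i - s * z i)\<^sup>2) * \<beta>"
    unfolding c2 using \<beta> by (intro mult_right_mono) auto
  then show ?thesis
    unfolding X_def using n P by (simp add: field_simps)
qed

lemma outside_cone_upper:
  assumes n: "n > 0" and c: "vnorm n c = sqrt (real n * P)" and th: "cos th \<ge> 0" "\<beta> * (sin th)\<^sup>2 = 1"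
  shows "emeasure (gauss n (\<lambda>_. 0) \<sigma>) {z \<in> space (gauss n (\<lambda>_. 0) \<sigma>). (\<lambda>i. c i + z i) \<notin> cone n c th}
    \<le> ennreal (exp (- real n * E1))"
proof -
  let ?N = "gauss n (\<lambda>_. 0) \<sigma>"
  have [measurable]: "(\<lambda>z. X n c z) \<in> borel_measurable ?N"
    unfolding X_def by measurable
  have "emeasure ?N {z \<in> space ?N. (\<lambda>i. c i + z i) \<notin> cone n c th}
    \<le> emeasure ?N {z \<in> space ?N. 0 \<le> (q - 1) * (real n / 2) * (X n c z - 1)}"
  proof (rule emeasure_mono)
    show "{z \<in> space ?N. (\<lambda>i. c i + z i) \<notin> cone n c th} \<subseteq> {z \<in> space ?N. 0 \<le> (q - 1) * (real n / 2) * (X n c z - 1)}"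
      using X_ge_outside_cone[OF n c th(1)] q unfolding th(2) by auto
  qed measurable
  also have "\<dots> \<le> ennreal (exp (- real n * E1))"
    unfolding mgf_X[OF n c, symmetric] by (rule emeasure_le_nn_integral_exp) measurable
  finally show ?thesis .
qed

text \<open>The alternative \<open>q2\<close> mirrors the two regimes of
  \<open>scaled_exp_ge\<close>: \<rho> = 1 works in any cone with nonnegative \<open>cos th\<close>,
  while \<rho> < 1 requires \<beta> sin^2 \<phi> \<le> 1 throughout the cone.\<close>

lemma pair_upper:
  assumes n: "n \<ge> 2" and c: "vnorm n c = sqrt (real n * P)" and th: "cos th \<ge> 0"
    and q2: "q = 2 \<or> q \<le> 2 \<and> \<beta> * (sin th)\<^sup>2 \<le> 1"
  shows "(\<integral>\<^sup>+ce. ennreal (pair_err n \<sigma> th c ce) \<partial>sphere_unif n P)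
     \<le> ennreal (2 * sqrt (real n) * exp (1/2) * \<beta> powr (- ((real n - 1) / 2)) * exp (- real n * E1))"
proof -
  let ?G = "gauss n (\<lambda>_. 0) 1" and ?N = "gauss n (\<lambda>_. 0) \<sigma>"
  let ?y = "\<lambda>z i. c i + z i"
  let ?B = "2 * sqrt (real n) * exp (1/2) * \<beta> powr (- ((real n - 1) / 2))"
  have n0: "n > 0" using n by simp
  have [measurable]: "(\<lambda>z. X n c z) \<in> borel_measurable ?N"
    unfolding X_def by measurable
  have c0: "vnorm n c > 0" using c n P by simp
  have "(\<integral>\<^sup>+ce. ennreal (pair_err n \<sigma> th c ce) \<partial>sphere_unif n P)
    \<le> (\<integral>\<^sup>+z. ennreal ?B * ennreal (exp ((q - 1) * (real n / 2) * (X n c z - 1))) \<partial>?N)"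
    unfolding pair_err_average[OF sig P n0 c]
  proof (rule nn_integral_mono_AE)
    have "AE z in ?N. z 0 \<noteq> - c 0" by (rule AE_gauss_neq) (use n sig in auto)
    then show "AE z in ?N. (if ?y z \<in> cone n c th then emeasure ?G {g \<in> space ?G. vinner n (?y z) c * vnorm n g \<le> sqrt (real n * P) * vinner n (?y z) g} else 0)
       \<le> ennreal ?B * ennreal (exp ((q - 1) * (real n / 2) * (X n c z - 1)))"
    proof eventually_elim
      case (elim z)
      show ?case
      proof (cases "?y z \<in> cone n c th")
        case True
        let ?r = "vnorm n (?y z)"
        have "?r \<noteq> 0" using elim n by (auto simp: vnorm_eq_0_iff intro!: exI[of _ 0])
        then have r: "?r > 0" using vnorm_nonneg[of n "?y z"] by linarith
        define x where "x = vinner n (?y z) c / (?r * vnorm n c)"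
        have x: "vinner n (?y z) c = x * ?r * vnorm n c" using r c0 by (simp add: x_def)
        have xc: "cos th \<le> x" using True r c0 by (simp add: x_def cone_def field_simps)
        \<comment> \<open>An upper bound for sin^2 \<phi> whose powers are again exponentials of a
          quadratic form in z, with the factor \<beta>^(-(n-1)/2) split off.\<close>
        define m where "m = exp ((q - 1) * (X n c z - 1)) / \<beta>"
        have "\<beta> * (1 - x\<^sup>2) \<le> exp ((q - 1) * (X n c z - 1))"
        proof (rule scaled_exp_ge)
          show "q - 1 = 1 \<or> \<beta> * (1 - x\<^sup>2) \<le> 1"
          proof (cases "q = 2")
            case False
            have "(cos th)\<^sup>2 \<le> x\<^sup>2" using xc th by (intro power_mono) auto
            then have "\<beta> * (1 - x\<^sup>2) \<le> \<beta> * (sin th)\<^sup>2"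
              using \<beta> by (intro mult_left_mono) (auto simp: sin_squared_eq)
            with False q2 show ?thesis by auto
          qed simp
        qed (use q q2 X_ge[OF n0 c x] in auto)
        then have m: "1 - x\<^sup>2 \<le> m" using \<beta> by (simp add: m_def field_simps)
        have m0: "m > 0" using \<beta> by (simp add: m_def)
        define u where "u i = ?y z i / ?r" for i
        have u1: "(\<Sum>i<n. (u i)\<^sup>2) = 1"
          using r unfolding u_def power_divide sum_divide_distrib[symmetric] vnorm_sq[symmetric] by simp
        have ug: "vinner n (?y z) g = ?r * vinner n u g" for g
          using r unfolding vinner_def sum_distrib_left u_def by (intro sum.cong) auto
        have "emeasure ?G {g \<in> space ?G. vinner n (?y z) c * vnorm n g \<le> sqrt (real n * P) * vinner n (?y z) g}
          = emeasure ?G {g \<in> space ?G. x * vnorm n g \<le> vinner n u g}"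
        proof -
          have "vinner n (?y z) c * vnorm n g \<le> sqrt (real n * P) * vinner n (?y z) g \<longleftrightarrow>
            (?r * vnorm n c) * (x * vnorm n g) \<le> (?r * vnorm n c) * vinner n u g" for g
            unfolding x unfolding ug c by (simp add: mult_ac)
          then show ?thesis using r c0 by simp
        qed
        also have "\<dots> \<le> ennreal (2 * sqrt (real n) * m powr ((real n - 1) / 2))"
          using xc th by (intro cap_upper n u1 m m0) auto
        also have "\<dots> \<le> ennreal (?B * exp ((q - 1) * (real n / 2) * (X n c z - 1)))"
        proof (rule ennreal_leI)
          have "m powr ((real n - 1) / 2) = exp ((q - 1) * (X n c z - 1) * ((real n - 1) / 2)) * \<beta> powr (- ((real n - 1) / 2))"
            using \<beta> unfolding m_def powr_minus divide_inverse by (subst powr_mult) (auto simp: exp_powr_real inverse_powr[symmetric] powr_minus[symmetric])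
          also have "\<dots> \<le> (exp (1/2) * exp ((q - 1) * (real n / 2) * (X n c z - 1))) * \<beta> powr (- ((real n - 1) / 2))"
          proof (rule mult_right_mono)
            \<comment> \<open>The cap has exponent (n - 1) / 2 but the moment was computed for n /
              2. The discrepancy is (q - 1) (1 - X) / 2 \<le> 1/2, whence the constant exp
              (1/2).\<close>
            have "(q - 1) * (1 - X n c z) \<le> 1 * 1"
            proof (cases "X n c z \<le> 1")
              case True
              then show ?thesis using q q2 X_nonneg[of n c z] by (intro mult_mono) auto
            next
              case False
              then have "(q - 1) * (1 - X n c z) \<le> 0" using q by (intro mult_nonneg_nonpos) auto
              then show ?thesis by simp
            qed
            then have "(q - 1) * (X n c z - 1) * ((real n - 1) / 2) \<le> 1/2 + (q - 1) * (real n / 2) * (X n c z - 1)"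
              by (simp add: field_simps)
            then show "exp ((q - 1) * (X n c z - 1) * ((real n - 1) / 2)) \<le> exp (1/2) * exp ((q - 1) * (real n / 2) * (X n c z - 1))"
              unfolding exp_add[symmetric] by simp
          qed simp
          finally have "2 * sqrt (real n) * m powr ((real n - 1) / 2) \<le> 2 * sqrt (real n) *
              ((exp (1/2) * exp ((q - 1) * (real n / 2) * (X n c z - 1))) * \<beta> powr (- ((real n - 1) / 2)))"
            by (intro mult_left_mono) auto
          then show "2 * sqrt (real n) * m powr ((real n - 1) / 2) \<le> ?B * exp ((q - 1) * (real n / 2) * (X n c z - 1))"
            by (simp add: mult_ac)
        qed
        finally show ?thesis using True by (simp add: ennreal_mult)
      qed simp
    qed
  qed
  also have "\<dots> = ennreal ?B * ennreal (exp (- real n * E1))"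
    unfolding mgf_X[OF n0 c, symmetric] by (rule nn_integral_cmult) measurable
  finally show ?thesis by (simp add: ennreal_mult)
qed

end

section \<open>Change of measure\<close>

text \<open>A common reference measure for all means and variances, so that likelihood ratios can be
  compared pointwise.\<close>

lemma gauss_eq_density:
  assumes s: "\<sigma> > 0"
  shows "gauss n \<mu> \<sigma> = density (PiM {..<n} (\<lambda>_. lborel)) (\<lambda>x. \<Prod>i<n. ennreal (normal_density (\<mu> i) \<sigma> (x i)))"
proof -
  interpret product_sigma_finite "\<lambda>i. gauss1 (\<mu> i) \<sigma>"
    by (rule product_sigma_finite_gauss1[OF s])
  interpret L: product_sigma_finite "\<lambda>_::nat. lborel :: real measure"
    by standard
  let ?L = "PiM {..<n} (\<lambda>_. lborel :: real measure)" and ?f = "\<lambda>i x. ennreal (normal_density (\<mu> i) \<sigma> x)"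
  have "density ?L (\<lambda>x. \<Prod>i<n. ?f i (x i)) = PiM {..<n} (\<lambda>i. gauss1 (\<mu> i) \<sigma>)"
  proof (rule PiM_eqI)
    show "sets (density ?L (\<lambda>x. \<Prod>i<n. ?f i (x i))) = sets (PiM {..<n} (\<lambda>i. gauss1 (\<mu> i) \<sigma>))"
      unfolding sets_density by (intro sets_PiM_cong) auto
    fix A assume A: "\<And>i. i \<in> {..<n} \<Longrightarrow> A i \<in> sets (gauss1 (\<mu> i) \<sigma>)"
    then have [measurable]: "A i \<in> sets borel" if "i < n" for i using that by simp
    have PiE: "Pi\<^sub>E {..<n} A \<in> sets ?L"
      using A by (intro sets_PiM_I_finite) auto
    have "emeasure (density ?L (\<lambda>x. \<Prod>i<n. ?f i (x i))) (Pi\<^sub>E {..<n} A)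
      = (\<integral>\<^sup>+x. (\<Prod>i<n. ?f i (x i)) * indicator (Pi\<^sub>E {..<n} A) x \<partial>?L)"
      by (rule emeasure_density[OF _ PiE]) measurable
    also have "\<dots> = (\<integral>\<^sup>+x. (\<Prod>i<n. ?f i (x i) * indicator (A i) (x i)) \<partial>?L)"
    proof (rule nn_integral_cong)
      fix x assume x: "x \<in> space ?L"
      show "(\<Prod>i<n. ?f i (x i)) * indicator (Pi\<^sub>E {..<n} A) x = (\<Prod>i<n. ?f i (x i) * indicator (A i) (x i))"
      proof (cases "\<forall>i<n. x i \<in> A i")
        case True
        then have "x \<in> Pi\<^sub>E {..<n} A" using x by (auto simp: space_PiM PiE_iff)
        then show ?thesis using True by (simp add: PiE_iff)
      next
        case False
        then obtain i where "i < n" "x i \<notin> A i" by auto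
        then have "(\<Prod>i<n. ?f i (x i) * indicator (A i) (x i)) = 0"
          by (intro prod_zero) (auto intro!: bexI[of _ i])
        moreover have "x \<notin> Pi\<^sub>E {..<n} A" using False by auto
        ultimately show ?thesis by simp
      qed
    qed
    also have "\<dots> = (\<Prod>i<n. \<integral>\<^sup>+x. ?f i x * indicator (A i) x \<partial>lborel)"
      by (rule L.product_nn_integral_prod) auto
    also have "\<dots> = (\<Prod>i<n. emeasure (gauss1 (\<mu> i) \<sigma>) (A i))"
      by (intro prod.cong refl emeasure_density[symmetric]) auto
    finally show "emeasure (density ?L (\<lambda>x. \<Prod>i<n. ?f i (x i))) (Pi\<^sub>E {..<n} A) = (\<Prod>i<n. emeasure (gauss1 (\<mu> i) \<sigma>) (A i))" .
  qed simp
  then show ?thesis by (simp add: gauss_def)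
qed

lemma normal_density_ratio:
  assumes "\<sigma> > 0" "\<tau> > 0"
  shows "normal_density 0 \<sigma> x = exp (ln (\<tau> / \<sigma>) - x\<^sup>2 / (2 * \<sigma>\<^sup>2) + (x - \<mu>)\<^sup>2 / (2 * \<tau>\<^sup>2)) * normal_density \<mu> \<tau> x"
proof -
  have "exp (ln (\<tau> / \<sigma>) - x\<^sup>2 / (2 * \<sigma>\<^sup>2) + (x - \<mu>)\<^sup>2 / (2 * \<tau>\<^sup>2)) * exp (- (x - \<mu>)\<^sup>2 / (2 * \<tau>\<^sup>2))
     = exp (ln (\<tau> / \<sigma>) + (- (x - 0)\<^sup>2 / (2 * \<sigma>\<^sup>2)))"
    unfolding exp_add[symmetric] by simp
  also have "\<dots> = \<tau> / \<sigma> * exp (- (x - 0)\<^sup>2 / (2 * \<sigma>\<^sup>2))"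
    using assms unfolding exp_add by simp
  finally show ?thesis
    unfolding normal_density_def using assms by (simp add: real_sqrt_mult field_simps)
qed

text \<open>The assumption bounds from below, on A only, the logarithm of the likelihood ratio of
  the untilted to the tilted law.\<close>

lemma gauss_change_of_measure:
  assumes s: "\<sigma> > 0" "\<tau> > 0" and A: "A \<in> sets (PiM {..<n} (\<lambda>_. borel))"
    and k: "\<And>x. x \<in> A \<Longrightarrow> k \<le> real n * ln (\<tau> / \<sigma>) - (\<Sum>i<n. (x i)\<^sup>2) / (2 * \<sigma>\<^sup>2) + (\<Sum>i<n. (x i - \<mu> i)\<^sup>2) / (2 * \<tau>\<^sup>2)"
  shows "ennreal (exp k) * emeasure (gauss n \<mu> \<tau>) A \<le> emeasure (gauss n (\<lambda>_. 0) \<sigma>) A"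
proof -
  let ?L = "PiM {..<n} (\<lambda>_. lborel :: real measure)"
  have "sets ?L = sets (PiM {..<n} (\<lambda>_. borel))" by (intro sets_PiM_cong) auto
  with A have [measurable]: "A \<in> sets ?L" by simp
  have "ennreal (exp k) * emeasure (gauss n \<mu> \<tau>) A
    = ennreal (exp k) * (\<integral>\<^sup>+x. (\<Prod>i<n. ennreal (normal_density (\<mu> i) \<tau> (x i))) * indicator A x \<partial>?L)"
    unfolding gauss_eq_density[OF s(2)] by (subst emeasure_density) auto
  also have "\<dots> = (\<integral>\<^sup>+x. ennreal (exp k) * ((\<Prod>i<n. ennreal (normal_density (\<mu> i) \<tau> (x i))) * indicator A x) \<partial>?L)"
    by (rule nn_integral_cmult[symmetric]) measurable
  also have "\<dots> \<le> (\<integral>\<^sup>+x. (\<Prod>i<n. ennreal (normal_density 0 \<sigma> (x i))) * indicator A x \<partial>?L)"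
  proof (rule nn_integral_mono)
    fix x
    show "ennreal (exp k) * ((\<Prod>i<n. ennreal (normal_density (\<mu> i) \<tau> (x i))) * indicator A x)
      \<le> (\<Prod>i<n. ennreal (normal_density 0 \<sigma> (x i))) * indicator A x"
    proof (cases "x \<in> A")
      case True
      have "(\<Prod>i<n. normal_density 0 \<sigma> (x i)) =
        exp (\<Sum>i<n. ln (\<tau> / \<sigma>) - (x i)\<^sup>2 / (2 * \<sigma>\<^sup>2) + (x i - \<mu> i)\<^sup>2 / (2 * \<tau>\<^sup>2)) * (\<Prod>i<n. normal_density (\<mu> i) \<tau> (x i))"
        unfolding exp_sum[OF finite_lessThan] prod.distrib[symmetric]
        by (intro prod.cong refl normal_density_ratio s)
      also have "(\<Sum>i<n. ln (\<tau> / \<sigma>) - (x i)\<^sup>2 / (2 * \<sigma>\<^sup>2) + (x i - \<mu> i)\<^sup>2 / (2 * \<tau>\<^sup>2))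
        = real n * ln (\<tau> / \<sigma>) - (\<Sum>i<n. (x i)\<^sup>2) / (2 * \<sigma>\<^sup>2) + (\<Sum>i<n. (x i - \<mu> i)\<^sup>2) / (2 * \<tau>\<^sup>2)"
        by (simp add: sum.distrib sum_subtractf sum_divide_distrib)
      finally have "exp k * (\<Prod>i<n. normal_density (\<mu> i) \<tau> (x i)) \<le> (\<Prod>i<n. normal_density 0 \<sigma> (x i))"
        using k[OF True] by (simp add: mult_right_mono prod_nonneg)
      then have "ennreal (exp k * (\<Prod>i<n. normal_density (\<mu> i) \<tau> (x i))) \<le> ennreal (\<Prod>i<n. normal_density 0 \<sigma> (x i))"
        by (rule ennreal_leI)
      then show ?thesis using True by (simp add: prod_ennreal ennreal_mult prod_nonneg)
    qed simp
  qed
  also have "\<dots> = emeasure (gauss n (\<lambda>_. 0) \<sigma>) A"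
    unfolding gauss_eq_density[OF s(1)] by (subst emeasure_density) auto
  finally show ?thesis .
qed

lemma gauss_chernoff:
  assumes s: "\<sigma> > 0" and k: "k = 1 - 2 * a * \<sigma>\<^sup>2" "k > 0"
  shows "measure (gauss n \<mu> \<sigma>) {x \<in> space (gauss n \<mu> \<sigma>). K \<le> a * (\<Sum>i<n. (x i - \<mu> i)\<^sup>2) + (\<Sum>i<n. b i * (x i - \<mu> i))}
    \<le> exp ((\<Sum>i<n. (b i)\<^sup>2) * \<sigma>\<^sup>2 / (2 * k) - K - real n * (ln k / 2))"
proof -
  let ?G = "gauss n \<mu> \<sigma>" and ?h = "\<lambda>x. a * (\<Sum>i<n. (x i - \<mu> i)\<^sup>2) + (\<Sum>i<n. b i * (x i - \<mu> i))"
  interpret G: prob_space ?G by (rule prob_space_gauss[OF s])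
  have kn: "sqrt k ^ n = exp (real n * (ln k / 2))"
    using k(2) unfolding exp_of_nat_mult by (simp add: powr_half_sqrt[symmetric] powr_def)
  have "emeasure ?G {x \<in> space ?G. K \<le> ?h x} = emeasure ?G {x \<in> space ?G. 0 \<le> ?h x - K}"
    by simp
  also have "\<dots> \<le> (\<integral>\<^sup>+x. ennreal (exp (?h x - K)) \<partial>?G)"
    by (rule emeasure_le_nn_integral_exp) measurable
  also have "\<dots> = (\<integral>\<^sup>+x. ennreal (exp (- K)) * ennreal (exp (?h x)) \<partial>?G)"
    by (simp add: ennreal_mult[symmetric] exp_add[symmetric])
  also have "\<dots> = ennreal (exp (- K)) * ennreal (exp ((\<Sum>i<n. (b i)\<^sup>2) * \<sigma>\<^sup>2 / (2 * k)) / sqrt k ^ n)"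
    by (subst nn_integral_cmult) (measurable, subst gauss_mgf[OF s k], simp)
  also have "\<dots> = ennreal (exp ((\<Sum>i<n. (b i)\<^sup>2) * \<sigma>\<^sup>2 / (2 * k) - K - real n * (ln k / 2)))"
    unfolding kn exp_diff exp_minus
    by (subst ennreal_mult[symmetric]) (auto intro!: arg_cong[where f=ennreal] simp: field_simps)
  finally show ?thesis
    unfolding G.emeasure_eq_measure by (simp add: ennreal_le_iff)
qed

text \<open>The decay rate d depends on neither the dimension nor the mean nor the direction u; this
  carries the uniformity in the codeword through the lower bound.\<close>

lemma gauss_tails:
  assumes s: "\<tau> > 0" and \<eta>: "\<eta> > 0"
  obtains d where "d > 0" "\<And>n \<mu> u. (\<Sum>i<n. (u i)\<^sup>2) = 1 \<Longrightarrow>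
     measure (gauss n \<mu> \<tau>) {x \<in> space (gauss n \<mu> \<tau>). \<eta> * sqrt (real n) \<le> (\<Sum>i<n. u i * (x i - \<mu> i))} \<le> exp (- real n * d)"
     "\<And>n \<mu>. measure (gauss n \<mu> \<tau>) {x \<in> space (gauss n \<mu> \<tau>). real n * (\<tau>\<^sup>2 + \<eta>) \<le> (\<Sum>i<n. (x i - \<mu> i)\<^sup>2)} \<le> exp (- real n * d)"
     "\<And>n \<mu>. measure (gauss n \<mu> \<tau>) {x \<in> space (gauss n \<mu> \<tau>). (\<Sum>i<n. (x i - \<mu> i)\<^sup>2) \<le> real n * (\<tau>\<^sup>2 - \<eta>)} \<le> exp (- real n * d)"
proof -
  \<comment> \<open>The quadratic tails gain r w in the exponent and lose at most 4 r^2 through the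
    logarithm. The bound r \<le> w / 8 makes the loss at most half the gain; r \<le> 1/4 keeps 2 r
    in the range of the logarithm estimate.\<close>
  define r where "r = min (1/4) (\<eta> / (8 * \<tau>\<^sup>2))"
  define w where "w = \<eta> / \<tau>\<^sup>2"
  define t where "t = r / \<tau>\<^sup>2"
  define d where "d = min (\<eta>\<^sup>2 / (2 * \<tau>\<^sup>2)) (r * w / 2)"
  have r: "r > 0" "r \<le> 1/4" "r \<le> w / 8" using s \<eta> by (auto simp: r_def w_def)
  have w: "w > 0" using s \<eta> by (simp add: w_def)
  have rr: "4 * r\<^sup>2 \<le> r * w / 2" using mult_left_mono[OF r(3), of r] r by (simp add: power2_eq_square)
  have d: "d > 0" "d \<le> \<eta>\<^sup>2 / (2 * \<tau>\<^sup>2)" "d \<le> r * w / 2" using s \<eta> r w by (auto simp: d_def)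
  have t: "t * \<tau>\<^sup>2 = r" "t * \<eta> = r * w" "t > 0" using s r by (auto simp: t_def w_def)
  have 1: "measure (gauss n \<mu> \<tau>) {x \<in> space (gauss n \<mu> \<tau>). \<eta> * sqrt (real n) \<le> (\<Sum>i<n. u i * (x i - \<mu> i))} \<le> exp (- real n * d)"
    if u: "(\<Sum>i<n. (u i)\<^sup>2) = 1" for n \<mu> u
  proof -
    have n: "n > 0" using u by (cases n) auto
    \<comment> \<open>The minimiser of l^2 \<tau>^2 / 2 - l \<eta> sqrt n.\<close>
    define l where "l = \<eta> * sqrt (real n) / \<tau>\<^sup>2"
    have l: "l > 0" using n s \<eta> by (simp add: l_def)
    have "\<eta> * sqrt (real n) \<le> S \<longleftrightarrow> l * (\<eta> * sqrt (real n)) \<le> l * S" for S using l by simp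
    then have "{x \<in> space (gauss n \<mu> \<tau>). \<eta> * sqrt (real n) \<le> (\<Sum>i<n. u i * (x i - \<mu> i))} =
      {x \<in> space (gauss n \<mu> \<tau>). l * (\<eta> * sqrt (real n)) \<le> 0 * (\<Sum>i<n. (x i - \<mu> i)\<^sup>2) + (\<Sum>i<n. (l * u i) * (x i - \<mu> i))}"
      by (simp add: sum_distrib_left mult.assoc)
    also have "measure (gauss n \<mu> \<tau>) \<dots> \<le> exp ((\<Sum>i<n. (l * u i)\<^sup>2) * \<tau>\<^sup>2 / (2 * 1) - l * (\<eta> * sqrt (real n)) - real n * (ln 1 / 2))"
      by (rule gauss_chernoff[OF s]) auto
    also have "(\<Sum>i<n. (l * u i)\<^sup>2) * \<tau>\<^sup>2 / (2 * 1) - l * (\<eta> * sqrt (real n)) - real n * (ln 1 / 2) = - real n * (\<eta>\<^sup>2 / (2 * \<tau>\<^sup>2))"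
      using s unfolding power_mult_distrib sum_distrib_left[symmetric] u l_def
      by (simp add: field_simps power2_eq_square)
    also have "exp (- real n * (\<eta>\<^sup>2 / (2 * \<tau>\<^sup>2))) \<le> exp (- real n * d)"
      using mult_left_mono[OF d(2), of "real n"] by simp
    finally show ?thesis .
  qed
  have 2: "measure (gauss n \<mu> \<tau>) {x \<in> space (gauss n \<mu> \<tau>). real n * (\<tau>\<^sup>2 + \<eta>) \<le> (\<Sum>i<n. (x i - \<mu> i)\<^sup>2)} \<le> exp (- real n * d)" for n \<mu>
  proof -
    have "real n * (\<tau>\<^sup>2 + \<eta>) \<le> S \<longleftrightarrow> t * (real n * (\<tau>\<^sup>2 + \<eta>)) \<le> t * S" for S using t by simp
    then have "{x \<in> space (gauss n \<mu> \<tau>). real n * (\<tau>\<^sup>2 + \<eta>) \<le> (\<Sum>i<n. (x i - \<mu> i)\<^sup>2)} =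
       {x \<in> space (gauss n \<mu> \<tau>). t * (real n * (\<tau>\<^sup>2 + \<eta>)) \<le> t * (\<Sum>i<n. (x i - \<mu> i)\<^sup>2) + (\<Sum>i<n. 0 * (x i - \<mu> i))}"
      by simp
    also have "measure (gauss n \<mu> \<tau>) \<dots> \<le> exp ((\<Sum>i<n. (0::real)\<^sup>2) * \<tau>\<^sup>2 / (2 * (1 - 2 * r)) - t * (real n * (\<tau>\<^sup>2 + \<eta>)) - real n * (ln (1 - 2 * r) / 2))"
      by (rule gauss_chernoff[OF s]) (use t r in auto)
    also have "t * (real n * (\<tau>\<^sup>2 + \<eta>)) = real n * (r + r * w)"
      unfolding t(2)[symmetric] by (simp add: algebra_simps t(1)[symmetric])
    also have "(\<Sum>i<n. (0::real)\<^sup>2) * \<tau>\<^sup>2 / (2 * (1 - 2 * r)) - real n * (r + r * w) - real n * (ln (1 - 2 * r) / 2)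
       = - real n * (r + r * w + ln (1 - 2 * r) / 2)" by (simp add: algebra_simps)
    also have "exp \<dots> \<le> exp (- real n * d)"
    proof -
      have "- (2 * r) - 2 * (2 * r)\<^sup>2 \<le> ln (1 - 2 * r)"
        using r by (intro ln_one_minus_pos_lower_bound) auto
      then have "d \<le> r + r * w + ln (1 - 2 * r) / 2" using d(3) rr by (simp add: power2_eq_square)
      then show ?thesis by (simp add: mult_left_mono)
    qed
    finally show ?thesis .
  qed
  have 3: "measure (gauss n \<mu> \<tau>) {x \<in> space (gauss n \<mu> \<tau>). (\<Sum>i<n. (x i - \<mu> i)\<^sup>2) \<le> real n * (\<tau>\<^sup>2 - \<eta>)} \<le> exp (- real n * d)" for n \<mu>
  proof -
    have "S \<le> real n * (\<tau>\<^sup>2 - \<eta>) \<longleftrightarrow> (- t) * (real n * (\<tau>\<^sup>2 - \<eta>)) \<le> (- t) * S" for S using t by simp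
    then have "{x \<in> space (gauss n \<mu> \<tau>). (\<Sum>i<n. (x i - \<mu> i)\<^sup>2) \<le> real n * (\<tau>\<^sup>2 - \<eta>)} =
       {x \<in> space (gauss n \<mu> \<tau>). (- t) * (real n * (\<tau>\<^sup>2 - \<eta>)) \<le> (- t) * (\<Sum>i<n. (x i - \<mu> i)\<^sup>2) + (\<Sum>i<n. 0 * (x i - \<mu> i))}"
      by simp
    also have "measure (gauss n \<mu> \<tau>) \<dots> \<le> exp ((\<Sum>i<n. (0::real)\<^sup>2) * \<tau>\<^sup>2 / (2 * (1 + 2 * r)) - (- t) * (real n * (\<tau>\<^sup>2 - \<eta>)) - real n * (ln (1 + 2 * r) / 2))"
      by (rule gauss_chernoff[OF s]) (use t r in auto)
    also have "(- t) * (real n * (\<tau>\<^sup>2 - \<eta>)) = real n * (r * w - r)"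
      unfolding t(2)[symmetric] by (simp add: algebra_simps t(1)[symmetric])
    also have "(\<Sum>i<n. (0::real)\<^sup>2) * \<tau>\<^sup>2 / (2 * (1 + 2 * r)) - real n * (r * w - r) - real n * (ln (1 + 2 * r) / 2)
       = - real n * (r * w - r + ln (1 + 2 * r) / 2)" by (simp add: algebra_simps)
    also have "exp \<dots> \<le> exp (- real n * d)"
    proof -
      have "2 * r - (2 * r)\<^sup>2 \<le> ln (1 + 2 * r)"
        using r by (intro ln_one_plus_pos_lower_bound) auto
      moreover have "0 \<le> r * w" using r w by simp
      ultimately have "d \<le> r * w - r + ln (1 + 2 * r) / 2" using d(3) rr by (simp add: power2_eq_square)
      then show ?thesis by (simp add: mult_left_mono)
    qed
    finally show ?thesis .
  qed
  show thesis using that[OF d(1) 1 2 3] .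
qed

lemma eventually_exp_decay:
  assumes "d > 0" "e > 0"
  shows "\<forall>\<^sub>F n in sequentially. exp (- real n * d) \<le> e"
proof -
  have "(\<lambda>n. exp (- real n * d)) \<longlonglongrightarrow> 0" using assms(1) by real_asymp
  from order_tendstoD(2)[OF this assms(2)] show ?thesis
    by eventually_elim simp
qed

lemma gauss_concentration:
  assumes s: "\<tau> > 0" and \<eta>: "\<eta> > 0"
  shows "\<forall>\<^sub>F n in sequentially. \<forall>u \<mu>. (\<Sum>i<n. (u i)\<^sup>2) = 1 \<longrightarrow>
    1 / 2 \<le> measure (gauss n \<mu> \<tau>) {x \<in> space (gauss n \<mu> \<tau>). \<bar>\<Sum>i<n. u i * (x i - \<mu> i)\<bar> \<le> \<eta> * sqrt (real n)
       \<and> \<bar>(\<Sum>i<n. (x i - \<mu> i)\<^sup>2) - real n * \<tau>\<^sup>2\<bar> \<le> real n * \<eta>}"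
proof -
  obtain d where d: "d > 0" and t1: "\<And>n \<mu> u. (\<Sum>i<n. (u i)\<^sup>2) = 1 \<Longrightarrow>
     measure (gauss n \<mu> \<tau>) {x \<in> space (gauss n \<mu> \<tau>). \<eta> * sqrt (real n) \<le> (\<Sum>i<n. u i * (x i - \<mu> i))} \<le> exp (- real n * d)"
     and t2: "\<And>n \<mu>. measure (gauss n \<mu> \<tau>) {x \<in> space (gauss n \<mu> \<tau>). real n * (\<tau>\<^sup>2 + \<eta>) \<le> (\<Sum>i<n. (x i - \<mu> i)\<^sup>2)} \<le> exp (- real n * d)"
     and t3: "\<And>n \<mu>. measure (gauss n \<mu> \<tau>) {x \<in> space (gauss n \<mu> \<tau>). (\<Sum>i<n. (x i - \<mu> i)\<^sup>2) \<le> real n * (\<tau>\<^sup>2 - \<eta>)} \<le> exp (- real n * d)"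
    by (rule gauss_tails[OF s \<eta>]) (rule that)
  \<comment> \<open>The complement is covered by four tail events, two for each quantity, so 1/8 for
    each leaves mass 1/2.\<close>
  have "\<forall>\<^sub>F n in sequentially. exp (- real n * d) \<le> 1/8"
    by (rule eventually_exp_decay[OF d]) simp
  then show ?thesis
  proof eventually_elim
    case (elim n)
    show ?case
    proof (intro allI impI)
      fix u \<mu> :: "nat \<Rightarrow> real" assume u: "(\<Sum>i<n. (u i)\<^sup>2) = 1"
      let ?G = "gauss n \<mu> \<tau>"
      interpret G: prob_space ?G by (rule prob_space_gauss[OF s])
      let ?S = "\<lambda>u x. \<Sum>i<n. u i * (x i - \<mu> i)" and ?Q = "\<lambda>x. \<Sum>i<n. (x i - \<mu> i)\<^sup>2"
      let ?A = "{x \<in> space ?G. \<bar>?S u x\<bar> \<le> \<eta> * sqrt (real n) \<and> \<bar>?Q x - real n * \<tau>\<^sup>2\<bar> \<le> real n * \<eta>}"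
      let ?B1 = "{x \<in> space ?G. \<eta> * sqrt (real n) \<le> ?S u x}"
      let ?B2 = "{x \<in> space ?G. \<eta> * sqrt (real n) \<le> ?S (\<lambda>i. - u i) x}"
      let ?B3 = "{x \<in> space ?G. real n * (\<tau>\<^sup>2 + \<eta>) \<le> ?Q x}"
      let ?B4 = "{x \<in> space ?G. ?Q x \<le> real n * (\<tau>\<^sup>2 - \<eta>)}"
      have ms [measurable]: "?A \<in> sets ?G" "?B1 \<in> sets ?G" "?B2 \<in> sets ?G" "?B3 \<in> sets ?G" "?B4 \<in> sets ?G"
        by measurable
      have "1 - measure ?G ?A = measure ?G (space ?G - ?A)"
        by (rule G.prob_compl[symmetric]) measurable
      also have "\<dots> \<le> measure ?G (?B1 \<union> ?B2 \<union> (?B3 \<union> ?B4))"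
      proof (rule G.finite_measure_mono)
        show "space ?G - ?A \<subseteq> ?B1 \<union> ?B2 \<union> (?B3 \<union> ?B4)"
        proof
          fix x assume "x \<in> space ?G - ?A"
          moreover have "?S (\<lambda>i. - u i) x = - ?S u x" by (simp add: sum_negf)
          moreover have "real n * (\<tau>\<^sup>2 + \<eta>) = real n * \<tau>\<^sup>2 + real n * \<eta>" "real n * (\<tau>\<^sup>2 - \<eta>) = real n * \<tau>\<^sup>2 - real n * \<eta>"
            by (simp_all add: algebra_simps)
          ultimately show "x \<in> ?B1 \<union> ?B2 \<union> (?B3 \<union> ?B4)"
            by (simp only: Un_iff mem_Collect_eq Diff_iff abs_le_iff de_Morgan_conj not_le) (elim conjE disjE; linarith?; auto)
        qed
      qed measurable
      also have "\<dots> \<le> measure ?G (?B1 \<union> ?B2) + measure ?G (?B3 \<union> ?B4)"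
        by (intro measure_Un_le sets.Un ms)
      also have "\<dots> \<le> (measure ?G ?B1 + measure ?G ?B2) + (measure ?G ?B3 + measure ?G ?B4)"
        by (intro add_mono measure_Un_le ms)
      finally show "1/2 \<le> measure ?G ?A"
        using t1[of u n \<mu>] t1[of "\<lambda>i. - u i" n \<mu>] t2[of n \<mu>] t3[of n \<mu>] elim u by simp
    qed
  qed
qed

text \<open>Relative entropy per dimension of the Gaussian with mean a sqrt n along a unit vector
  and coordinate variance v, with respect to centred noise of variance \<sigma>^2.\<close>

definition rate :: "real \<Rightarrow> real \<Rightarrow> real \<Rightarrow> real" where
  "rate \<sigma> a v = (a\<^sup>2 + v) / (2 * \<sigma>\<^sup>2) - 1 / 2 - ln (v / \<sigma>\<^sup>2) / 2"

text \<open>A lower bound in the manner of Cramer: the shell has mass at least 1/2 under the tilted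
  law, and on a narrow shell the likelihood ratio is exp (-n rate) up to a small exponential
  error.\<close>

lemma gauss_shell_lower:
  assumes s: "\<sigma> > 0" and v: "v > 0" and \<eta>: "\<eta> > 0" and \<delta>: "\<delta> > 0"
  shows "\<forall>\<^sub>F n in sequentially. \<forall>u. (\<Sum>i<n. (u i)\<^sup>2) = 1 \<longrightarrow>
    ennreal (exp (- real n * (rate \<sigma> a v + \<delta>))) \<le> emeasure (gauss n (\<lambda>_. 0) \<sigma>)
      {z \<in> space (gauss n (\<lambda>_. 0) \<sigma>). \<bar>vinner n u z - a * sqrt (real n)\<bar> \<le> \<eta> * sqrt (real n)
       \<and> \<bar>(vnorm n z)\<^sup>2 - real n * (a\<^sup>2 + v)\<bar> \<le> real n * \<eta>}"
proof -
  \<comment> \<open>On the shell of width e, |z|^2 deviates by at most n b e: the cross term gives 2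
    |a| e, the centred square gives e. The width is chosen so that the log-likelihood loses at most
    n \<delta> / 2; the other half of \<delta> pays for the mass 1/2.\<close>
  define b where "b = 2 * \<bar>a\<bar> + 1"
  define e where "e = min (\<eta> / b) (\<delta> / 2 / (b / (2 * \<sigma>\<^sup>2) + 1 / (2 * v)))"
  have b: "b \<ge> 1" by (simp add: b_def)
  have pos: "b / (2 * \<sigma>\<^sup>2) + 1 / (2 * v) > 0" using b s v by (intro add_pos_pos) auto
  have e: "e > 0" "b * e \<le> \<eta>"
    using b s v \<eta> \<delta> pos by (auto simp: e_def min_def field_simps)
  have "e \<le> \<delta> / 2 / (b / (2 * \<sigma>\<^sup>2) + 1 / (2 * v))" by (simp add: e_def)
  then have e3: "e * (b / (2 * \<sigma>\<^sup>2) + 1 / (2 * v)) \<le> \<delta> / 2" by (simp only: pos_le_divide_eq[OF pos])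
  have e4: "e \<le> \<eta>" using e b mult_right_mono[of 1 b e] by linarith
  have sv: "sqrt v > 0" "(sqrt v)\<^sup>2 = v" using v by auto
  show ?thesis
    using gauss_concentration[OF sv(1) e(1)] eventually_exp_decay[OF half_gt_zero[OF \<delta>] half_gt_zero[OF zero_less_one]]
  proof eventually_elim
    case (elim n)
    show ?case
    proof (intro allI impI)
      fix u :: "nat \<Rightarrow> real" assume u: "(\<Sum>i<n. (u i)\<^sup>2) = 1"
      define \<mu> where "\<mu> = (\<lambda>i. a * sqrt (real n) * u i)"
      let ?G = "gauss n \<mu> (sqrt v)" and ?N = "gauss n (\<lambda>_. 0) \<sigma>"
      interpret G: prob_space ?G by (rule prob_space_gauss) (use v in simp)
      let ?S = "\<lambda>x. \<Sum>i<n. u i * (x i - \<mu> i)" and ?Q = "\<lambda>x. \<Sum>i<n. (x i - \<mu> i)\<^sup>2"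
      let ?A = "{x \<in> space ?G. \<bar>?S x\<bar> \<le> e * sqrt (real n) \<and> \<bar>?Q x - real n * (sqrt v)\<^sup>2\<bar> \<le> real n * e}"
      let ?T = "{z \<in> space ?N. \<bar>vinner n u z - a * sqrt (real n)\<bar> \<le> \<eta> * sqrt (real n)
       \<and> \<bar>(vnorm n z)\<^sup>2 - real n * (a\<^sup>2 + v)\<bar> \<le> real n * \<eta>}"
      have A[measurable]: "?A \<in> sets (PiM {..<n} (\<lambda>_. borel))"
        unfolding sets_gauss[of n \<mu> "sqrt v", symmetric] by measurable
      have "1/2 \<le> measure ?G ?A"
        using elim(1) u by blast
      then have half: "ennreal (1/2) \<le> emeasure ?G ?A"
        unfolding G.emeasure_eq_measure by (rule ennreal_leI)
      have inner: "vinner n u x = a * sqrt (real n) + ?S x" for x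
      proof -
        have "?S x = vinner n u x - a * sqrt (real n) * (\<Sum>i<n. (u i)\<^sup>2)"
          unfolding vinner_def \<mu>_def sum_distrib_left sum_subtractf[symmetric]
          by (intro sum.cong) (auto simp: algebra_simps power2_eq_square)
        then show ?thesis using u by simp
      qed
      have norm: "(vnorm n x)\<^sup>2 = real n * a\<^sup>2 + 2 * a * sqrt (real n) * ?S x + ?Q x" for x
      proof -
        have "(\<Sum>i<n. (x i)\<^sup>2) = a\<^sup>2 * (sqrt (real n))\<^sup>2 * (\<Sum>i<n. (u i)\<^sup>2) + 2 * a * sqrt (real n) * ?S x + ?Q x"
          unfolding \<mu>_def sum_distrib_left sum.distrib[symmetric]
          by (intro sum.cong) (auto simp: algebra_simps power2_eq_square)
        then show ?thesis using u unfolding vnorm_sq by (simp add: mult.commute)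
      qed
      have bd: "\<bar>?S x\<bar> \<le> e * sqrt (real n)" "\<bar>?Q x - real n * v\<bar> \<le> real n * e"
        "\<bar>(vnorm n x)\<^sup>2 - real n * (a\<^sup>2 + v)\<bar> \<le> real n * (b * e)" if "x \<in> ?A" for x
      proof -
        show 1: "\<bar>?S x\<bar> \<le> e * sqrt (real n)" and 2: "\<bar>?Q x - real n * v\<bar> \<le> real n * e"
          using that v by auto
        have "\<bar>2 * a * sqrt (real n) * ?S x\<bar> = 2 * \<bar>a\<bar> * sqrt (real n) * \<bar>?S x\<bar>"
          by (simp add: abs_mult)
        also have "\<dots> \<le> 2 * \<bar>a\<bar> * sqrt (real n) * (e * sqrt (real n))"
          using 1 by (intro mult_left_mono) auto
        also have "\<dots> = real n * (2 * \<bar>a\<bar> * e)" by simp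
        finally have "\<bar>2 * a * sqrt (real n) * ?S x\<bar> \<le> real n * (2 * \<bar>a\<bar> * e)" .
        moreover have "(vnorm n x)\<^sup>2 - real n * (a\<^sup>2 + v) = 2 * a * sqrt (real n) * ?S x + (?Q x - real n * v)"
          unfolding norm by (simp add: algebra_simps)
        moreover have "real n * (b * e) = real n * (2 * \<bar>a\<bar> * e) + real n * e"
          unfolding b_def by (simp add: algebra_simps)
        ultimately show "\<bar>(vnorm n x)\<^sup>2 - real n * (a\<^sup>2 + v)\<bar> \<le> real n * (b * e)"
          using 2 by linarith
      qed
      have "?A \<subseteq> ?T"
      proof safe
        fix x assume x: "x \<in> space ?G" "\<bar>?S x\<bar> \<le> e * sqrt (real n)" "\<bar>?Q x - real n * (sqrt v)\<^sup>2\<bar> \<le> real n * e"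
        then have xA: "x \<in> ?A" by simp
        show "x \<in> space ?N" using x(1) by (simp add: space_gauss)
        have "e * sqrt (real n) \<le> \<eta> * sqrt (real n)" using e4 by (intro mult_right_mono) auto
        then show "\<bar>vinner n u x - a * sqrt (real n)\<bar> \<le> \<eta> * sqrt (real n)"
          using x(2) unfolding inner by simp
        have "real n * (b * e) \<le> real n * \<eta>" using e(2) by (intro mult_left_mono) auto
        then show "\<bar>(vnorm n x)\<^sup>2 - real n * (a\<^sup>2 + v)\<bar> \<le> real n * \<eta>"
          using bd(3)[OF xA] by linarith
      qed
      have "ennreal (exp (- real n * (rate \<sigma> a v + \<delta>))) \<le> ennreal (exp (- real n * (rate \<sigma> a v + \<delta> / 2)) * (1 / 2))"
      proof (rule ennreal_leI)
        have "exp (- real n * (rate \<sigma> a v + \<delta>)) = exp (- real n * (rate \<sigma> a v + \<delta> / 2)) * exp (- real n * (\<delta> / 2))"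
          unfolding exp_add[symmetric] by (simp add: field_simps)
        also have "\<dots> \<le> exp (- real n * (rate \<sigma> a v + \<delta> / 2)) * (1 / 2)"
          using elim(2) by (intro mult_left_mono) auto
        finally show "exp (- real n * (rate \<sigma> a v + \<delta>)) \<le> \<dots>" .
      qed
      also have "\<dots> = ennreal (exp (- real n * (rate \<sigma> a v + \<delta> / 2))) * ennreal (1 / 2)"
        by (rule ennreal_mult) auto
      also have "\<dots> \<le> ennreal (exp (- real n * (rate \<sigma> a v + \<delta> / 2))) * emeasure ?G ?A"
        using half by (intro mult_left_mono) auto
      also have "\<dots> \<le> emeasure ?N ?A"
      proof (rule gauss_change_of_measure[OF s sv(1) A])
        fix x assume xA: "x \<in> ?A"
        have ln: "ln (sqrt v / \<sigma>) = ln (v / \<sigma>\<^sup>2) / 2"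
          using s v by (simp add: ln_div ln_sqrt ln_realpow)
        have "(\<Sum>i<n. (x i)\<^sup>2) \<le> real n * (a\<^sup>2 + v) + real n * (b * e)"
          using bd(3)[OF xA] unfolding vnorm_sq by linarith
        then have 1: "(\<Sum>i<n. (x i)\<^sup>2) / (2 * \<sigma>\<^sup>2) \<le> (real n * (a\<^sup>2 + v) + real n * (b * e)) / (2 * \<sigma>\<^sup>2)"
          by (intro divide_right_mono) auto
        have "real n * v - real n * e \<le> ?Q x"
          using bd(2)[OF xA] by linarith
        then have 2: "(real n * v - real n * e) / (2 * v) \<le> ?Q x / (2 * (sqrt v)\<^sup>2)"
          using v by (simp add: divide_right_mono)
        have 3: "real n * (e * (b / (2 * \<sigma>\<^sup>2) + 1 / (2 * v))) \<le> real n * (\<delta> / 2)"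
          using e3 by (intro mult_left_mono) auto
        have 4: "real n * (e * (b / (2 * \<sigma>\<^sup>2) + 1 / (2 * v))) = real n * (b * e) / (2 * \<sigma>\<^sup>2) + real n * e / (2 * v)"
          by (simp add: field_simps)
        have 5: "- real n * (rate \<sigma> a v + \<delta> / 2) = real n * (ln (v / \<sigma>\<^sup>2) / 2) - real n * (a\<^sup>2 + v) / (2 * \<sigma>\<^sup>2) + real n / 2 - real n * (\<delta> / 2)"
        proof -
          have "- real n * (t - 1 / 2 - l / 2 + \<delta> / 2) = real n * (l / 2) - real n * t + real n / 2 - real n * (\<delta> / 2)" for t l
            by (simp add: algebra_simps)
          then show ?thesis unfolding rate_def times_divide_eq_right[symmetric] .
        qed
        have 6: "(real n * v - real n * e) / (2 * v) = real n / 2 - real n * e / (2 * v)"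
          using v by (simp add: field_simps)
        show "- real n * (rate \<sigma> a v + \<delta> / 2) \<le> real n * ln (sqrt v / \<sigma>) - (\<Sum>i<n. (x i)\<^sup>2) / (2 * \<sigma>\<^sup>2) + ?Q x / (2 * (sqrt v)\<^sup>2)"
          using 1 2 3 unfolding 4 5 6 ln add_divide_distrib by linarith
      qed
      also have "\<dots> \<le> emeasure ?N ?T"
      proof (rule emeasure_mono)
        show "?T \<in> sets ?N" by measurable
      qed fact
      finally show "ennreal (exp (- real n * (rate \<sigma> a v + \<delta>))) \<le> emeasure ?N ?T" .
    qed
  qed
qed

section \<open>Lower bound for a pair of codewords\<close>

lemma vnorm_add_sq:
  "(vnorm n (\<lambda>i. x i + y i))\<^sup>2 = (vnorm n x)\<^sup>2 + 2 * vinner n x y + (vnorm n y)\<^sup>2"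
  unfolding vnorm_sq vinner_def sum_distrib_left sum.distrib[symmetric]
  by (intro sum.cong) (auto simp: power2_eq_square algebra_simps)

text \<open>On the shell, y = c + z has component about h sqrt n along c and squared norm about n
  (h^2 + v). The numbers t and x1 bracket the cosine of its angle: t keeps y in the cone, x1 bounds
  the size of the cap the competitor must hit. The constant 2 sqrt P + 1 collects the error of the
  cross term with c and that of |z|^2.\<close>

lemma pair_lower_det:
  assumes h: "h = sqrt P + a" and P: "P > 0" and n: "n > 0"
    and c: "vnorm n c = sqrt (real n * P)" and u: "u = (\<lambda>i. c i / sqrt (real n * P))"
    and z1: "\<bar>vinner n u z - a * sqrt (real n)\<bar> \<le> \<eta> * sqrt (real n)"
    and z2: "\<bar>(vnorm n z)\<^sup>2 - real n * (a\<^sup>2 + v)\<bar> \<le> real n * \<eta>"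
    and \<eta>: "\<eta> > 0" "h - \<eta> > 0" "h\<^sup>2 + v - (2 * sqrt P + 1) * \<eta> > 0"
    and t: "0 \<le> t" "t * sqrt (h\<^sup>2 + v + (2 * sqrt P + 1) * \<eta>) \<le> h - \<eta>"
    and x1: "0 \<le> x1" "h + \<eta> \<le> x1 * sqrt (h\<^sup>2 + v - (2 * sqrt P + 1) * \<eta>)"
  shows "vnorm n (\<lambda>i. c i + z i) * vnorm n c * t \<le> vinner n (\<lambda>i. c i + z i) c"
    and "vinner n (\<lambda>i. c i + z i) c \<le> sqrt (real n * P) * x1 * vnorm n (\<lambda>i. c i + z i)"
    and "vnorm n (\<lambda>i. c i + z i) > 0"
proof -
  let ?y = "\<lambda>i. c i + z i" and ?s = "sqrt (real n)" and ?K = "2 * sqrt P + 1"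
  let ?r = "vnorm n ?y"
  have s: "?s > 0" "?s\<^sup>2 = real n" using n by auto
  have c2: "(vnorm n c)\<^sup>2 = real n * P" unfolding c using P by simp
  have c0: "vnorm n c > 0" unfolding c using P n by simp
  have nP: "sqrt (real n * P) = ?s * sqrt P" by (simp add: real_sqrt_mult)
  define w where "w = vinner n u z"
  have cz: "vinner n c z = sqrt (real n * P) * w"
    using P n unfolding w_def u vinner_def sum_distrib_left by (intro sum.cong) auto
  have w: "(a - \<eta>) * ?s \<le> w" "w \<le> (a + \<eta>) * ?s"
    using z1 unfolding w_def[symmetric] by (auto simp: abs_le_iff algebra_simps)
  have "vinner n ?y c = (vnorm n c)\<^sup>2 + vinner n c z"
    unfolding vnorm_sq vinner_def sum.distrib[symmetric]
    by (intro sum.cong) (auto simp: power2_eq_square algebra_simps)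
  also have "\<dots> = sqrt (real n * P) * (?s * sqrt P + w)"
    unfolding c2 cz nP using P by (simp add: algebra_simps)
  finally have yc: "vinner n ?y c = sqrt (real n * P) * (?s * sqrt P + w)" .
  have p: "?s * (h - \<eta>) \<le> ?s * sqrt P + w" "?s * sqrt P + w \<le> ?s * (h + \<eta>)"
    using w unfolding h by (auto simp: algebra_simps)
  have r2: "?r\<^sup>2 = real n * P + 2 * (?s * sqrt P) * w + (vnorm n z)\<^sup>2"
    unfolding vnorm_add_sq c2 cz nP by simp
  have "\<bar>w - a * ?s\<bar> \<le> \<eta> * ?s" using z1 unfolding w_def .
  then have "2 * (?s * sqrt P) * \<bar>w - a * ?s\<bar> \<le> 2 * (?s * sqrt P) * (\<eta> * ?s)"
    using P by (intro mult_left_mono) auto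
  also have "\<dots> = real n * (2 * sqrt P * \<eta>)" by simp
  finally have w1: "2 * (?s * sqrt P) * \<bar>w - a * ?s\<bar> \<le> real n * (2 * sqrt P * \<eta>)" .
  have "2 * (?s * sqrt P) * w - 2 * real n * sqrt P * a = 2 * (?s * sqrt P) * (w - a * ?s)"
    by (simp add: algebra_simps)
  then have w2: "\<bar>2 * (?s * sqrt P) * w - 2 * real n * sqrt P * a\<bar> \<le> real n * (2 * sqrt P * \<eta>)"
    using P w1 by (simp add: abs_mult)
  have hh: "real n * (h\<^sup>2 + v) = real n * P + 2 * real n * sqrt P * a + real n * (a\<^sup>2 + v)"
    using P unfolding h by (simp add: power2_sum algebra_simps)
  have KK: "real n * (?K * \<eta>) = real n * (2 * sqrt P * \<eta>) + real n * \<eta>" by (simp add: algebra_simps)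
  have rb: "real n * (h\<^sup>2 + v - ?K * \<eta>) \<le> ?r\<^sup>2" "?r\<^sup>2 \<le> real n * (h\<^sup>2 + v + ?K * \<eta>)"
    using w2 z2 hh KK unfolding r2 right_diff_distrib[of "real n" "h\<^sup>2 + v"] distrib_left[of "real n" "h\<^sup>2 + v"] by linarith+
  have ru: "?r \<le> ?s * sqrt (h\<^sup>2 + v + ?K * \<eta>)"
    using real_sqrt_le_mono[OF rb(2)] by (simp add: real_sqrt_mult)
  have rl: "?s * sqrt (h\<^sup>2 + v - ?K * \<eta>) \<le> ?r"
    using real_sqrt_le_mono[OF rb(1)] by (simp add: real_sqrt_mult)
  show r0: "?r > 0" using rl s \<eta>(3) by (smt (verit) mult_pos_pos real_sqrt_gt_zero)
  have "?r * t \<le> ?s * sqrt (h\<^sup>2 + v + ?K * \<eta>) * t" using ru t(1) by (rule mult_right_mono)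
  also have "\<dots> = ?s * (t * sqrt (h\<^sup>2 + v + ?K * \<eta>))" by simp
  also have "\<dots> \<le> ?s * (h - \<eta>)" using t(2) by (intro mult_left_mono) auto
  also note p(1)
  finally have "vnorm n c * (?r * t) \<le> vnorm n c * (?s * sqrt P + w)" by (intro mult_left_mono) auto
  then show "?r * vnorm n c * t \<le> vinner n ?y c" unfolding yc c[symmetric] by (simp add: mult_ac)
  have "?s * sqrt P + w \<le> ?s * (h + \<eta>)" by (rule p)
  also have "\<dots> \<le> ?s * (x1 * sqrt (h\<^sup>2 + v - ?K * \<eta>))" using x1(2) by (intro mult_left_mono) auto
  also have "\<dots> = x1 * (?s * sqrt (h\<^sup>2 + v - ?K * \<eta>))" by simp
  also have "\<dots> \<le> x1 * ?r" using rl x1(1) by (intro mult_left_mono) auto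
  finally have "sqrt (real n * P) * (?s * sqrt P + w) \<le> sqrt (real n * P) * (x1 * ?r)"
    using P by (intro mult_left_mono) auto
  then show "vinner n ?y c \<le> sqrt (real n * P) * x1 * ?r" unfolding yc by (simp add: mult_ac)
qed

text \<open>With x0 = h / sqrt (h^2 + v) the cap exponent -ln (1 - x0^2) / 2 equals ln (1 + h^2 / v)
  / 2. Choosing x0 < x1 < a' with a' close to x0 makes all conditions strict at \<eta> = 0, so they
  survive for some small positive \<eta>.\<close>

lemma pair_lower_params:
  fixes h v t \<delta> K :: real
  assumes h: "h > 0" and v: "v > 0" and t: "t < h / sqrt (h\<^sup>2 + v)" and \<delta>: "\<delta> > 0"
  obtains a' x1 \<eta> where "0 < x1" "0 < a'" "a' < 1" "- ln (1 - a'\<^sup>2) / 2 < ln (1 + h\<^sup>2 / v) / 2 + \<delta>"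
    "\<eta> > 0" "h - \<eta> > 0" "h\<^sup>2 + v - K * \<eta> > 0" "t * sqrt (h\<^sup>2 + v + K * \<eta>) \<le> h - \<eta>"
    "h + \<eta> \<le> x1 * sqrt (h\<^sup>2 + v - K * \<eta>)" "x1 * sqrt (1 + \<eta>) \<le> a' - \<eta>"
proof -
  define x0 where "x0 = h / sqrt (h\<^sup>2 + v)"
  have hv: "h\<^sup>2 + v > 0" using v by (simp add: add_nonneg_pos)
  have sq: "sqrt (h\<^sup>2 + v) > 0" using hv by simp
  have x02: "x0\<^sup>2 = h\<^sup>2 / (h\<^sup>2 + v)" using hv by (simp add: x0_def power_divide)
  have x0: "x0 > 0" using h sq by (simp add: x0_def)
  have m: "1 - x0\<^sup>2 = v / (h\<^sup>2 + v)" unfolding x02 using hv by (simp add: field_simps)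
  have "x0\<^sup>2 < 1\<^sup>2" using m v hv by (smt (verit) divide_pos_pos one_power2)
  then have x01: "x0 < 1" by (rule power2_less_imp_less) simp
  have m0: "1 - x0\<^sup>2 > 0" unfolding m using v hv by simp
  have inv: "1 + h\<^sup>2 / v = inverse (1 - x0\<^sup>2)" unfolding m using v by (simp add: field_simps)
  have L: "- ln (1 - x0\<^sup>2) / 2 = ln (1 + h\<^sup>2 / v) / 2" unfolding inv using m0 by (simp add: ln_inverse)
  have "((\<lambda>x. - ln (1 - x\<^sup>2) / 2) \<longlongrightarrow> - ln (1 - x0\<^sup>2) / 2) (at_right x0)"
    using m0 by (intro tendsto_intros) auto
  then have "\<forall>\<^sub>F x in at_right x0. - ln (1 - x\<^sup>2) / 2 < ln (1 + h\<^sup>2 / v) / 2 + \<delta>"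
    using \<delta> by (intro order_tendstoD(2)[where y = "- ln (1 - x0\<^sup>2) / 2"]) (auto simp: L[simplified])
  moreover have "\<forall>\<^sub>F x in at_right x0. x \<in> {x0<..<1}"
    using x01 by (rule eventually_at_right_real)
  ultimately have "\<forall>\<^sub>F x in at_right x0. - ln (1 - x\<^sup>2) / 2 < ln (1 + h\<^sup>2 / v) / 2 + \<delta> \<and> x0 < x \<and> x < 1"
    by eventually_elim auto
  then obtain a' where a': "- ln (1 - a'\<^sup>2) / 2 < ln (1 + h\<^sup>2 / v) / 2 + \<delta>" "x0 < a'" "a' < 1"
    using eventually_happens'[OF trivial_limit_at_right_real] by blast
  define x1 where "x1 = (x0 + a') / 2"
  have x1: "x0 < x1" "x1 < a'" using a' by (auto simp: x1_def)
  have tt: "t * sqrt (h\<^sup>2 + v) < h" using t sq by (simp add: pos_less_divide_eq)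
  have xx: "h < x1 * sqrt (h\<^sup>2 + v)" using x1(1) sq unfolding x0_def by (simp add: pos_divide_less_eq)
  have 1: "\<forall>\<^sub>F \<eta> in at_right 0. h - \<eta> > 0"
  proof (rule order_tendstoD(1)[OF _ h])
    show "((\<lambda>\<eta>. h - \<eta>) \<longlongrightarrow> h) (at_right 0)" by (auto intro!: tendsto_eq_intros)
  qed
  have 2: "\<forall>\<^sub>F \<eta> in at_right 0. h\<^sup>2 + v - K * \<eta> > 0"
  proof (rule order_tendstoD(1)[OF _ hv])
    show "((\<lambda>\<eta>. h\<^sup>2 + v - K * \<eta>) \<longlongrightarrow> h\<^sup>2 + v) (at_right 0)" by (auto intro!: tendsto_eq_intros)
  qed
  have 3: "\<forall>\<^sub>F \<eta> in at_right 0. h - \<eta> - t * sqrt (h\<^sup>2 + v + K * \<eta>) > 0"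
  proof (rule order_tendstoD(1))
    show "((\<lambda>\<eta>. h - \<eta> - t * sqrt (h\<^sup>2 + v + K * \<eta>)) \<longlongrightarrow> h - t * sqrt (h\<^sup>2 + v)) (at_right 0)"
      by (auto intro!: tendsto_eq_intros)
  qed (use tt in simp)
  have 4: "\<forall>\<^sub>F \<eta> in at_right 0. x1 * sqrt (h\<^sup>2 + v - K * \<eta>) - (h + \<eta>) > 0"
  proof (rule order_tendstoD(1))
    show "((\<lambda>\<eta>. x1 * sqrt (h\<^sup>2 + v - K * \<eta>) - (h + \<eta>)) \<longlongrightarrow> x1 * sqrt (h\<^sup>2 + v) - h) (at_right 0)"
      by (auto intro!: tendsto_eq_intros)
  qed (use xx in simp)
  have 5: "\<forall>\<^sub>F \<eta> in at_right 0. a' - \<eta> - x1 * sqrt (1 + \<eta>) > 0"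
  proof (rule order_tendstoD(1))
    show "((\<lambda>\<eta>. a' - \<eta> - x1 * sqrt (1 + \<eta>)) \<longlongrightarrow> a' - x1) (at_right 0)"
      by (auto intro!: tendsto_eq_intros)
  qed (use x1 in simp)
  have 6: "\<forall>\<^sub>F \<eta> in at_right (0::real). \<eta> > 0" by (rule eventually_at_right_less)
  have "\<forall>\<^sub>F \<eta> in at_right 0. \<eta> > 0 \<and> h - \<eta> > 0 \<and> h\<^sup>2 + v - K * \<eta> > 0 \<and> h - \<eta> - t * sqrt (h\<^sup>2 + v + K * \<eta>) > 0
     \<and> x1 * sqrt (h\<^sup>2 + v - K * \<eta>) - (h + \<eta>) > 0 \<and> a' - \<eta> - x1 * sqrt (1 + \<eta>) > 0"
    using 1 2 3 4 5 6 by eventually_elim simp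
  then obtain \<eta> where \<eta>: "\<eta> > 0" "h - \<eta> > 0" "h\<^sup>2 + v - K * \<eta> > 0" "h - \<eta> - t * sqrt (h\<^sup>2 + v + K * \<eta>) > 0"
     "x1 * sqrt (h\<^sup>2 + v - K * \<eta>) - (h + \<eta>) > 0" "a' - \<eta> - x1 * sqrt (1 + \<eta>) > 0"
    using eventually_happens'[OF trivial_limit_at_right_real] by blast
  show thesis
    by (rule that[of x1 a' \<eta>]) (use x0 x1 a' \<eta> in auto)
qed

text \<open>Independence multiplies two costs: tilting the noise until y has the prescribed angle,
  and tilting the competitor's Gaussian into the cap around y. The second event may depend on y
  because the shell bound is uniform in the direction.\<close>

lemma pair_lower:
  assumes P: "P > 0" and s: "\<sigma> > 0" and h: "h = sqrt P + a" "h > 0" and v: "v > 0"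
    and th: "0 \<le> cos th" "cos th < h / sqrt (h\<^sup>2 + v)" and \<delta>: "\<delta> > 0"
  shows "\<forall>\<^sub>F n in sequentially. \<forall>c. vnorm n c = sqrt (real n * P) \<longrightarrow>
    ennreal (exp (- real n * (rate \<sigma> a v + ln (1 + h\<^sup>2 / v) / 2 + \<delta>)))
      \<le> (\<integral>\<^sup>+ce. ennreal (pair_err n \<sigma> th c ce) \<partial>sphere_unif n P)"
proof -
  let ?K = "2 * sqrt P + 1"
  obtain a' x1 \<eta> where x1: "0 < x1" and a': "0 < a'" "a' < 1" "- ln (1 - a'\<^sup>2) / 2 < ln (1 + h\<^sup>2 / v) / 2 + \<delta> / 3"
    and \<eta>: "\<eta> > 0" "h - \<eta> > 0" "h\<^sup>2 + v - ?K * \<eta> > 0" "cos th * sqrt (h\<^sup>2 + v + ?K * \<eta>) \<le> h - \<eta>"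
    "h + \<eta> \<le> x1 * sqrt (h\<^sup>2 + v - ?K * \<eta>)" "x1 * sqrt (1 + \<eta>) \<le> a' - \<eta>"
    by (rule pair_lower_params[OF h(2) v th(2), of "\<delta> / 3" ?K]) (use \<delta> in auto)
  have a'2: "1 - a'\<^sup>2 > 0" using a' by (simp add: power_less_one_iff abs_square_less_1)
  \<comment> \<open>Mean a' and variance 1 - a'^2 keep |g|^2 near n, so only the logarithm of the
    cap survives. The three thirds of \<delta> pay for the noise shell, the competitor's shell and
    the step from x0 to a'.\<close>
  have rate': "rate 1 a' (1 - a'\<^sup>2) = - ln (1 - a'\<^sup>2) / 2" by (simp add: rate_def)
  have \<delta>3: "\<delta> / 3 > 0" using \<delta> by simp
  show ?thesis
    using gauss_shell_lower[OF s v \<eta>(1) \<delta>3, of a]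
      gauss_shell_lower[OF zero_less_one a'2 \<eta>(1) \<delta>3, of a'] eventually_gt_at_top[of 0]
  proof eventually_elim
    case (elim n)
    show ?case
    proof (intro allI impI)
      fix c assume c: "vnorm n c = sqrt (real n * P)"
      let ?N = "gauss n (\<lambda>_. 0) \<sigma>" and ?G = "gauss n (\<lambda>_. 0) 1"
      define u where "u = (\<lambda>i. c i / sqrt (real n * P))"
      have u: "(\<Sum>i<n. (u i)\<^sup>2) = 1"
        using P elim(3) unfolding u_def power_divide sum_divide_distrib[symmetric] vnorm_sq[symmetric] c by simp
      let ?T = "{z \<in> space ?N. \<bar>vinner n u z - a * sqrt (real n)\<bar> \<le> \<eta> * sqrt (real n)
         \<and> \<bar>(vnorm n z)\<^sup>2 - real n * (a\<^sup>2 + v)\<bar> \<le> real n * \<eta>}"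
      let ?E2 = "ennreal (exp (- real n * (rate 1 a' (1 - a'\<^sup>2) + \<delta> / 3)))"
      have T: "?T \<in> sets ?N" by measurable
      have "ennreal (exp (- real n * (rate \<sigma> a v + ln (1 + h\<^sup>2 / v) / 2 + \<delta>))) \<le>
         ennreal (exp (- real n * (rate 1 a' (1 - a'\<^sup>2) + \<delta> / 3)) * exp (- real n * (rate \<sigma> a v + \<delta> / 3)))"
      proof (rule ennreal_leI)
        have "rate 1 a' (1 - a'\<^sup>2) + \<delta> / 3 + (rate \<sigma> a v + \<delta> / 3) \<le> rate \<sigma> a v + ln (1 + h\<^sup>2 / v) / 2 + \<delta>"
          using a'(3) unfolding rate' by linarith
        then have "real n * (rate 1 a' (1 - a'\<^sup>2) + \<delta> / 3 + (rate \<sigma> a v + \<delta> / 3)) \<le> real n * (rate \<sigma> a v + ln (1 + h\<^sup>2 / v) / 2 + \<delta>)"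
          by (intro mult_left_mono) auto
        then show "exp (- real n * (rate \<sigma> a v + ln (1 + h\<^sup>2 / v) / 2 + \<delta>)) \<le>
          exp (- real n * (rate 1 a' (1 - a'\<^sup>2) + \<delta> / 3)) * exp (- real n * (rate \<sigma> a v + \<delta> / 3))"
          unfolding exp_add[symmetric] exp_le_cancel_iff distrib_left by linarith
      qed
      also have "\<dots> = ?E2 * ennreal (exp (- real n * (rate \<sigma> a v + \<delta> / 3)))"
        by (rule ennreal_mult) auto
      also have "\<dots> \<le> ?E2 * emeasure ?N ?T"
        using elim(1) u by (intro mult_left_mono) auto
      also have "\<dots> = (\<integral>\<^sup>+z. ?E2 * indicator ?T z \<partial>?N)"
        by (rule nn_integral_cmult_indicator[OF T, symmetric])
      also have "\<dots> \<le> (\<integral>\<^sup>+ce. ennreal (pair_err n \<sigma> th c ce) \<partial>sphere_unif n P)"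
        unfolding pair_err_average[OF s P elim(3) c]
      proof (rule nn_integral_mono)
        fix z
        let ?y = "\<lambda>i. c i + z i"
        let ?S = "{g \<in> space ?G. vinner n ?y c * vnorm n g \<le> sqrt (real n * P) * vinner n ?y g}"
        show "?E2 * indicator ?T z \<le> (if ?y \<in> cone n c th then emeasure ?G ?S else 0)"
        proof (cases "z \<in> ?T")
          case True
          then have z: "\<bar>vinner n u z - a * sqrt (real n)\<bar> \<le> \<eta> * sqrt (real n)"
             "\<bar>(vnorm n z)\<^sup>2 - real n * (a\<^sup>2 + v)\<bar> \<le> real n * \<eta>" by auto
          note det = pair_lower_det[OF h(1) P elim(3) c u_def z \<eta>(1-3) th(1) \<eta>(4) less_imp_le[OF x1] \<eta>(5)]
          let ?r = "vnorm n ?y"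
          define u' where "u' = (\<lambda>i. ?y i / ?r)"
          have u': "(\<Sum>i<n. (u' i)\<^sup>2) = 1"
            using det(3) unfolding u'_def power_divide sum_divide_distrib[symmetric] vnorm_sq[symmetric] by simp
          let ?T' = "{g \<in> space ?G. \<bar>vinner n u' g - a' * sqrt (real n)\<bar> \<le> \<eta> * sqrt (real n)
             \<and> \<bar>(vnorm n g)\<^sup>2 - real n * (a'\<^sup>2 + (1 - a'\<^sup>2))\<bar> \<le> real n * \<eta>}"
          have "?E2 \<le> emeasure ?G ?T'" using elim(2) u' by blast
          also have "\<dots> \<le> emeasure ?G ?S"
          proof (rule emeasure_mono)
            show "?S \<in> sets ?G" by measurable
            show "?T' \<subseteq> ?S"
            proof safe
              fix g assume g: "\<bar>vinner n u' g - a' * sqrt (real n)\<bar> \<le> \<eta> * sqrt (real n)"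
                "\<bar>(vnorm n g)\<^sup>2 - real n * (a'\<^sup>2 + (1 - a'\<^sup>2))\<bar> \<le> real n * \<eta>"
              have g1: "(a' - \<eta>) * sqrt (real n) \<le> vinner n u' g"
                using g(1) unfolding left_diff_distrib by linarith
              have "(vnorm n g)\<^sup>2 \<le> real n * (1 + \<eta>)"
                using g(2) by (simp add: abs_le_iff algebra_simps)
              from real_sqrt_le_mono[OF this] have "vnorm n g \<le> sqrt (real n) * sqrt (1 + \<eta>)"
                by (simp add: real_sqrt_mult)
              then have "x1 * vnorm n g \<le> x1 * (sqrt (real n) * sqrt (1 + \<eta>))"
                using x1 by (intro mult_left_mono) auto
              also have "\<dots> = (x1 * sqrt (1 + \<eta>)) * sqrt (real n)" by simp
              also have "\<dots> \<le> (a' - \<eta>) * sqrt (real n)" using \<eta>(6) by (intro mult_right_mono) auto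
              also note g1
              finally have g2: "x1 * vnorm n g \<le> vinner n u' g" .
              have yg: "vinner n ?y g = ?r * vinner n u' g"
                using det(3) unfolding vinner_def sum_distrib_left u'_def by (intro sum.cong) auto
              have "vinner n ?y c * vnorm n g \<le> sqrt (real n * P) * x1 * ?r * vnorm n g"
                using det(2) by (intro mult_right_mono) auto
              also have "\<dots> = (sqrt (real n * P) * ?r) * (x1 * vnorm n g)" by simp
              also have "\<dots> \<le> (sqrt (real n * P) * ?r) * vinner n u' g"
                using g2 P by (intro mult_left_mono) auto
              finally show "vinner n ?y c * vnorm n g \<le> sqrt (real n * P) * vinner n ?y g"
                unfolding yg by simp
            qed
          qed
          moreover have "?y \<in> cone n c th" using det(1) by (simp add: cone_def)
          ultimately show ?thesis using True by simp
        qed simp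
      qed
      finally show "ennreal (exp (- real n * (rate \<sigma> a v + ln (1 + h\<^sup>2 / v) / 2 + \<delta>)))
        \<le> (\<integral>\<^sup>+ce. ennreal (pair_err n \<sigma> th c ce) \<partial>sphere_unif n P)" .
    qed
  qed
qed

section \<open>The ensemble average\<close>

lemma AE_sphere_unif:
  assumes n: "n > 0" and P: "P > 0"
  shows "AE c in sphere_unif n P. vnorm n c = sqrt (real n * P)"
proof -
  let ?G = "gauss n (\<lambda>_. 0) 1" and ?L = "PiM {..<n} (\<lambda>_. lborel :: real measure)"
  have "(\<lambda>c. vnorm n c) \<in> borel_measurable ?L"
    unfolding vnorm_def by measurable
  then have "{c \<in> space ?L. vnorm n c = sqrt (real n * P)} \<in> sets ?L"
    by measurable
  then have "(AE c in sphere_unif n P. vnorm n c = sqrt (real n * P)) \<longleftrightarrow>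
    (AE x in ?G. vnorm n (\<lambda>i\<in>{..<n}. sqrt (real n * P) * x i / vnorm n x) = sqrt (real n * P))"
    unfolding sphere_unif_def gauss_vec_eq by (rule AE_distr_iff[OF normalise_measurable])
  moreover have "AE x in ?G. vnorm n (\<lambda>i\<in>{..<n}. sqrt (real n * P) * x i / vnorm n x) = sqrt (real n * P)"
  proof -
    have "AE g in ?G. g 0 \<noteq> 0" by (rule AE_gauss_neq) (use n in auto)
    then show ?thesis
    proof eventually_elim
      case (elim g)
      then have "vnorm n g \<noteq> 0" using n by (auto simp: vnorm_eq_0_iff)
      then have g: "(vnorm n g)\<^sup>2 > 0" by simp
      have "(vnorm n (\<lambda>i\<in>{..<n}. sqrt (real n * P) * g i / vnorm n g))\<^sup>2 = (\<Sum>i<n. (real n * P / (vnorm n g)\<^sup>2) * (g i)\<^sup>2)"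
        unfolding vnorm_sq using P by (intro sum.cong) (auto simp: power_divide power_mult_distrib vnorm_sq)
      also have "\<dots> = real n * P"
        unfolding sum_distrib_left[symmetric] vnorm_sq[symmetric] using g by simp
      finally show ?case by (metis real_sqrt_unique vnorm_nonneg)
    qed
  qed
  ultimately show ?thesis by simp
qed

lemma pair_err_nonneg: "0 \<le> pair_err n \<sigma> th c ce"
  by (simp add: pair_err_def)

lemma pair_err_le_1: "\<sigma> > 0 \<Longrightarrow> pair_err n \<sigma> th c ce \<le> 1"
  unfolding pair_err_def gauss_vec_eq by (intro prob_space.prob_le_1 prob_space_gauss)

lemma ncw_pos: "ncw n R \<ge> 1"
  unfolding ncw_def by (simp add: Suc_le_eq)

text \<open>The number of competitors is \<open>ncw n R - 1\<close>, so the ceiling costs no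
  constant in the upper bound.\<close>

lemma ncw_bounds: "exp (real n * R) \<le> real (ncw n R)" "real (ncw n R) - 1 \<le> exp (real n * R)"
proof -
  have 0: "\<lceil>exp (real n * R)\<rceil> \<ge> 0" by (metis ceiling_mono ceiling_zero exp_ge_zero)
  have "real (ncw n R) = of_int \<lceil>exp (real n * R)\<rceil>" unfolding ncw_def using 0 by simp
  then show "exp (real n * R) \<le> real (ncw n R)" "real (ncw n R) - 1 \<le> exp (real n * R)"
    by linarith+
qed

lemma pair_err_component_measurable:
  assumes s: "\<sigma> > 0" and ij: "i \<in> I" "j \<in> I"
  shows "(\<lambda>cb. ennreal (pair_err n \<sigma> th (cb i) (cb j))) \<in> borel_measurable (PiM I (\<lambda>_. sphere_unif n P))"
proof -
  have comp: "(\<lambda>cb. cb l k) \<in> borel_measurable (PiM I (\<lambda>_. sphere_unif n P))" if "l \<in> I" "k < n" for l k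
  proof -
    have "(\<lambda>x. x k) \<in> borel_measurable (PiM {..<n} (\<lambda>_. borel :: real measure))"
      using that by (intro measurable_component_singleton) auto
    then have "(\<lambda>x. x k) \<in> borel_measurable (sphere_unif n P)"
      by (simp cong: measurable_cong_sets)
    from measurable_compose[OF measurable_component_singleton[OF that(1)] this] show ?thesis .
  qed
  show ?thesis using comp ij by (intro measurable_ennreal_pair_err[OF s]) auto
qed

text \<open>Splitting off the independent coordinate j leaves \<open>cb i\<close> fixed in the inner
  integral, to which the bounds uniform in the codeword apply.\<close>

lemma ensemble_pair_average:
  fixes I :: "nat set"
  assumes s: "\<sigma> > 0" and P: "P > 0" and n: "n > 0" and I: "finite I" "i \<in> I" "j \<in> I" "i \<noteq> j"
  shows "(\<integral>\<^sup>+cb. ennreal (pair_err n \<sigma> th (cb i) (cb j)) \<partial>PiM I (\<lambda>_. sphere_unif n P))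
     = (\<integral>\<^sup>+cb. (\<integral>\<^sup>+ce. ennreal (pair_err n \<sigma> th (cb i) ce) \<partial>sphere_unif n P) \<partial>PiM (I - {j}) (\<lambda>_. sphere_unif n P))"
proof -
  interpret S: prob_space "sphere_unif n P" by (rule prob_space_sphere_unif)
  interpret product_sigma_finite "\<lambda>_::nat. sphere_unif n P" by standard
  have I': "insert j (I - {j}) = I" using I by auto
  have "(\<lambda>cb. ennreal (pair_err n \<sigma> th (cb i) (cb j))) \<in> borel_measurable (PiM (insert j (I - {j})) (\<lambda>_. sphere_unif n P))"
    unfolding I' by (rule pair_err_component_measurable[OF s I(2,3)])
  from product_nn_integral_insert[OF _ _ this] I show ?thesis unfolding I' by simp
qed

lemma pair_err_ensemble_bounds:
  fixes L U :: real and I :: "nat set"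
  assumes s: "\<sigma> > 0" and P: "P > 0" and n: "n > 0" and I: "finite I" "i \<in> I" "j \<in> I" "i \<noteq> j"
    and LU: "0 \<le> L" "0 \<le> U"
  shows "integrable (PiM I (\<lambda>_. sphere_unif n P)) (\<lambda>cb. pair_err n \<sigma> th (cb i) (cb j))"
    and "(\<And>c. vnorm n c = sqrt (real n * P) \<Longrightarrow> ennreal L \<le> (\<integral>\<^sup>+ce. ennreal (pair_err n \<sigma> th c ce) \<partial>sphere_unif n P)) \<Longrightarrow>
       L \<le> (\<integral>cb. pair_err n \<sigma> th (cb i) (cb j) \<partial>PiM I (\<lambda>_. sphere_unif n P))"
    and "(\<And>c. vnorm n c = sqrt (real n * P) \<Longrightarrow> (\<integral>\<^sup>+ce. ennreal (pair_err n \<sigma> th c ce) \<partial>sphere_unif n P) \<le> ennreal U) \<Longrightarrow>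
       (\<integral>cb. pair_err n \<sigma> th (cb i) (cb j) \<partial>PiM I (\<lambda>_. sphere_unif n P)) \<le> U"
proof -
  let ?S = "sphere_unif n P"
  let ?M = "PiM I (\<lambda>_. ?S)" and ?M' = "PiM (I - {j}) (\<lambda>_. ?S)"
  let ?f = "\<lambda>cb. pair_err n \<sigma> th (cb i) (cb j)"
  interpret M: prob_space ?M by (intro prob_space_PiM prob_space_sphere_unif)
  interpret M': prob_space ?M' by (intro prob_space_PiM prob_space_sphere_unif)
  have "(\<lambda>cb. enn2real (ennreal (?f cb))) \<in> borel_measurable ?M"
    using pair_err_component_measurable[OF s I(2,3)] by measurable
  then have f: "?f \<in> borel_measurable ?M" by (simp add: pair_err_nonneg)
  show int: "integrable ?M ?f"
    by (rule M.integrable_const_bound[where B=1]) (use f s pair_err_nonneg pair_err_le_1 in auto)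
  have eq: "ennreal (\<integral>cb. ?f cb \<partial>?M) = (\<integral>\<^sup>+cb. (\<integral>\<^sup>+ce. ennreal (pair_err n \<sigma> th (cb i) ce) \<partial>?S) \<partial>?M')"
    unfolding ensemble_pair_average[OF s P n I, symmetric]
    by (rule nn_integral_eq_integral[symmetric, OF int]) (simp add: pair_err_nonneg)
  have nn: "0 \<le> (\<integral>cb. ?f cb \<partial>?M)" by (intro integral_nonneg_AE) (simp add: pair_err_nonneg)
  have AE: "AE cb in ?M'. vnorm n (cb i) = sqrt (real n * P)"
    using I AE_sphere_unif[OF n P] by (intro AE_PiM_component prob_space_sphere_unif) auto
  { assume L: "\<And>c. vnorm n c = sqrt (real n * P) \<Longrightarrow> ennreal L \<le> (\<integral>\<^sup>+ce. ennreal (pair_err n \<sigma> th c ce) \<partial>?S)"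
    have "ennreal L = (\<integral>\<^sup>+cb. ennreal L \<partial>?M')" by (simp add: M'.emeasure_space_1)
    also have "\<dots> \<le> (\<integral>\<^sup>+cb. (\<integral>\<^sup>+ce. ennreal (pair_err n \<sigma> th (cb i) ce) \<partial>?S) \<partial>?M')"
      by (rule nn_integral_mono_AE) (use AE in eventually_elim, rule L)
    finally show "L \<le> (\<integral>cb. ?f cb \<partial>?M)" unfolding eq[symmetric] using nn by (simp add: ennreal_le_iff)
  }
  { assume U: "\<And>c. vnorm n c = sqrt (real n * P) \<Longrightarrow> (\<integral>\<^sup>+ce. ennreal (pair_err n \<sigma> th c ce) \<partial>?S) \<le> ennreal U"
    have "(\<integral>\<^sup>+cb. (\<integral>\<^sup>+ce. ennreal (pair_err n \<sigma> th (cb i) ce) \<partial>?S) \<partial>?M') \<le> (\<integral>\<^sup>+cb. ennreal U \<partial>?M')"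
      by (rule nn_integral_mono_AE) (use AE in eventually_elim, rule U)
    also have "\<dots> = ennreal U" by (simp add: M'.emeasure_space_1)
    finally show "(\<integral>cb. ?f cb \<partial>?M) \<le> U" unfolding eq[symmetric] using LU by (simp add: ennreal_le_iff)
  }
qed

lemma P_union_bounds:
  assumes s: "\<sigma> > 0" and P: "P > 0" and n: "n > 0" and LU: "0 \<le> L" "0 \<le> U"
  shows "(\<And>c. vnorm n c = sqrt (real n * P) \<Longrightarrow> ennreal L \<le> (\<integral>\<^sup>+ce. ennreal (pair_err n \<sigma> th c ce) \<partial>sphere_unif n P)) \<Longrightarrow>
       (real (ncw n R) - 1) * L \<le> P_union n P \<sigma> R th"
    and "(\<And>c. vnorm n c = sqrt (real n * P) \<Longrightarrow> (\<integral>\<^sup>+ce. ennreal (pair_err n \<sigma> th c ce) \<partial>sphere_unif n P) \<le> ennreal U) \<Longrightarrow>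
       P_union n P \<sigma> R th \<le> (real (ncw n R) - 1) * U"
proof -
  let ?m = "ncw n R"
  let ?M = "PiM {..<?m} (\<lambda>_. sphere_unif n P)"
  let ?e = "\<lambda>i j. \<integral>cb. pair_err n \<sigma> th (cb i) (cb j) \<partial>?M"
  have m: "real ?m \<ge> 1" using ncw_pos[of n R] by simp
  note b = pair_err_ensemble_bounds[OF s P n finite_lessThan[of ?m] _ _ _ LU]
  have eq: "P_union n P \<sigma> R th = (1 / real ?m) * (\<Sum>i<?m. \<Sum>j\<in>{..<?m} - {i}. ?e i j)"
    unfolding P_union_def codebook_ens_def
    by (subst integral_mult_right_zero, subst Bochner_Integration.integral_sum)
       (auto intro!: Bochner_Integration.integrable_sum b(1) sum.cong Bochner_Integration.integral_sum)
  have cnt: "(1 / real ?m) * (\<Sum>i<?m. \<Sum>j\<in>{..<?m} - {i}. V) = (real ?m - 1) * V" for V :: real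
    using m by (simp add: of_nat_diff)
  { assume *: "\<And>c. vnorm n c = sqrt (real n * P) \<Longrightarrow> ennreal L \<le> (\<integral>\<^sup>+ce. ennreal (pair_err n \<sigma> th c ce) \<partial>sphere_unif n P)"
    show "(real ?m - 1) * L \<le> P_union n P \<sigma> R th"
      unfolding eq cnt[symmetric] by (intro mult_left_mono sum_mono b(2) *) auto }
  { assume *: "\<And>c. vnorm n c = sqrt (real n * P) \<Longrightarrow> (\<integral>\<^sup>+ce. ennreal (pair_err n \<sigma> th c ce) \<partial>sphere_unif n P) \<le> ennreal U"
    show "P_union n P \<sigma> R th \<le> (real ?m - 1) * U"
      unfolding eq cnt[symmetric] by (intro mult_left_mono sum_mono b(3) *) auto }
qed

lemma P_union_nonneg: "0 \<le> P_union n P \<sigma> R th"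
  unfolding P_union_def
  by (intro integral_nonneg_AE AE_I2 mult_nonneg_nonneg sum_nonneg pair_err_nonneg) auto

text \<open>At rate 0 the ratio in exp_le is x / 0 = 0, which counts as minus infinity.\<close>
lemma P_union_rate_0: "P_union n P \<sigma> 0 th = 0"
proof -
  have 1: "ncw n 0 = 1" by (simp add: ncw_def)
  have 2: "{..<1::nat} = {0}" by auto
  show ?thesis unfolding P_union_def 1 2 by simp
qed

lemma (in gallager) P_union_upper:
  assumes th: "cos th \<ge> 0" and q2: "q = 2 \<or> q \<le> 2 \<and> \<beta> * (sin th)\<^sup>2 \<le> 1"
  shows "exp_le (\<lambda>n. P_union n P \<sigma> R th) (\<lambda>n. exp (- real n * (E1 + ln \<beta> / 2 - R)))"
proof (rule exp_leI)
  fix e :: real assume e: "e > 0"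
  \<comment> \<open>The last factor is sqrt \<beta>, the difference between \<beta>^(-(n-1)/2) and
    \<beta>^(-n/2). Together with sqrt n it is absorbed by exp (n e).\<close>
  define C where "C = 2 * exp (1/2) * exp (ln \<beta> / 2)"
  have "(\<lambda>n. C * sqrt (real n) * exp (- real n * e)) \<longlonglongrightarrow> 0"
    using e by real_asymp
  from order_tendstoD(2)[OF this zero_less_one]
  show "\<forall>\<^sub>F n in sequentially. 0 < exp (- real n * (E1 + ln \<beta> / 2 - R)) \<longrightarrow>
     P_union n P \<sigma> R th \<le> exp (real n * e) * exp (- real n * (E1 + ln \<beta> / 2 - R))"
    using eventually_ge_at_top[of 2]
  proof eventually_elim
    case (elim n)
    define U where "U = 2 * sqrt (real n) * exp (1/2) * \<beta> powr (- ((real n - 1) / 2)) * exp (- real n * E1)"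
    have U: "U \<ge> 0" by (simp add: U_def)
    have "P_union n P \<sigma> R th \<le> (real (ncw n R) - 1) * U"
    proof (rule P_union_bounds(2)[OF sig P _ U U])
      show "(\<integral>\<^sup>+ce. ennreal (pair_err n \<sigma> th c ce) \<partial>sphere_unif n P) \<le> ennreal U"
        if "vnorm n c = sqrt (real n * P)" for c
        unfolding U_def by (rule pair_upper[OF elim(2) that th q2])
    qed (use elim in auto)
    also have "\<dots> \<le> exp (real n * R) * U"
      using ncw_bounds(2)[of n R] U by (intro mult_right_mono)
    also have "\<dots> = C * sqrt (real n) * exp (- real n * (E1 + ln \<beta> / 2 - R))"
    proof -
      have "\<beta> powr (- ((real n - 1) / 2)) = exp (ln \<beta> / 2 - real n * (ln \<beta> / 2))"
        using \<beta> by (simp add: powr_def field_simps)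
      then have "exp (real n * R) * U = 2 * sqrt (real n) * exp (1/2) * (exp (real n * R) * exp (ln \<beta> / 2 - real n * (ln \<beta> / 2)) * exp (- real n * E1))"
        by (simp add: U_def)
      also have "exp (real n * R) * exp (ln \<beta> / 2 - real n * (ln \<beta> / 2)) * exp (- real n * E1)
         = exp (ln \<beta> / 2) * exp (- real n * (E1 + ln \<beta> / 2 - R))"
        unfolding exp_add[symmetric] by (simp add: algebra_simps)
      finally show ?thesis by (simp add: C_def)
    qed
    also have "\<dots> \<le> exp (real n * e) * exp (- real n * (E1 + ln \<beta> / 2 - R))"
    proof (rule mult_right_mono)
      have "C * sqrt (real n) * exp (- real n * e) * exp (real n * e) \<le> 1 * exp (real n * e)"
        using elim(1) by (intro mult_right_mono) auto
      then show "C * sqrt (real n) \<le> exp (real n * e)"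
        by (simp add: mult.assoc exp_add[symmetric])
    qed simp
    finally show ?case by simp
  qed
qed simp

section \<open>Comparison of the region probability with the union bound\<close>

lemma P_region_le:
  assumes s: "\<sigma> > 0" and P: "P > 0" and n: "n > 0" and B: "B \<ge> 0"
    and *: "\<And>c. vnorm n c = sqrt (real n * P) \<Longrightarrow>
      emeasure (gauss n (\<lambda>_. 0) \<sigma>) {z \<in> space (gauss n (\<lambda>_. 0) \<sigma>). (\<lambda>i. c i + z i) \<notin> cone n c th} \<le> ennreal B"
  shows "P_region n P \<sigma> th \<le> B"
proof -
  let ?c = "\<lambda>i::nat. if i = 0 then sqrt (real n * P) else 0"
  interpret N: prob_space "gauss n (\<lambda>_. 0) \<sigma>" by (rule prob_space_gauss[OF s])
  have "(\<Sum>i<n. (?c i)\<^sup>2) = (\<Sum>i<n. if i = 0 then real n * P else 0)"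
    using P by (intro sum.cong) auto
  also have "\<dots> = real n * P" using n by simp
  finally have "vnorm n ?c = sqrt (real n * P)" unfolding vnorm_def by simp
  from *[OF this] show ?thesis
    unfolding P_region_def Let_def gauss_vec_eq using B by (simp add: N.emeasure_eq_measure)
qed

lemma halfspace_upper:
  assumes s: "\<sigma> > 0" and P: "P > 0" and n: "n > 0" and c: "vnorm n c = sqrt (real n * P)"
  shows "emeasure (gauss n (\<lambda>_. 0) \<sigma>) {z \<in> space (gauss n (\<lambda>_. 0) \<sigma>). (\<lambda>i. c i + z i) \<notin> cone n c (pi / 2)}
    \<le> ennreal (exp (- real n * (P / \<sigma>\<^sup>2 / 2)))"
proof -
  let ?N = "gauss n (\<lambda>_. 0) \<sigma>"
  interpret N: prob_space ?N by (rule prob_space_gauss[OF s])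
  have c2: "(\<Sum>i<n. (c i)\<^sup>2) = real n * P" unfolding vnorm_sq[symmetric] c using P by simp
  let ?K = "real n * P / \<sigma>\<^sup>2"
  have "measure ?N {z \<in> space ?N. (\<lambda>i. c i + z i) \<notin> cone n c (pi / 2)}
    \<le> measure ?N {z \<in> space ?N. ?K \<le> 0 * (\<Sum>i<n. (z i - 0)\<^sup>2) + (\<Sum>i<n. (- c i / \<sigma>\<^sup>2) * (z i - 0))}"
  proof (rule N.finite_measure_mono)
    show "{z \<in> space ?N. (\<lambda>i. c i + z i) \<notin> cone n c (pi / 2)}
      \<subseteq> {z \<in> space ?N. ?K \<le> 0 * (\<Sum>i<n. (z i - 0)\<^sup>2) + (\<Sum>i<n. (- c i / \<sigma>\<^sup>2) * (z i - 0))}"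
    proof safe
      fix z assume "(\<lambda>i. c i + z i) \<notin> cone n c (pi / 2)"
      then have "vinner n (\<lambda>i. c i + z i) c < 0" by (simp add: cone_def)
      also have "vinner n (\<lambda>i. c i + z i) c = real n * P + (\<Sum>i<n. c i * z i)"
        unfolding c2[symmetric] vinner_def sum.distrib[symmetric]
        by (intro sum.cong) (auto simp: power2_eq_square algebra_simps)
      finally have "real n * P / \<sigma>\<^sup>2 \<le> - (\<Sum>i<n. c i * z i) / \<sigma>\<^sup>2"
        by (intro divide_right_mono) auto
      then show "?K \<le> 0 * (\<Sum>i<n. (z i - 0)\<^sup>2) + (\<Sum>i<n. (- c i / \<sigma>\<^sup>2) * (z i - 0))"
        by (simp add: sum_negf sum_divide_distrib)
    qed
  qed measurable
  also have "\<dots> \<le> exp ((\<Sum>i<n. (- c i / \<sigma>\<^sup>2)\<^sup>2) * \<sigma>\<^sup>2 / (2 * 1) - ?K - real n * (ln 1 / 2))"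
    by (rule gauss_chernoff[OF s]) auto
  also have "(\<Sum>i<n. (- c i / \<sigma>\<^sup>2)\<^sup>2) * \<sigma>\<^sup>2 / (2 * 1) - ?K - real n * (ln 1 / 2) = - real n * (P / \<sigma>\<^sup>2 / 2)"
    unfolding power_divide power2_minus sum_divide_distrib[symmetric] c2 using s
    by (simp add: field_simps power2_eq_square)
  finally show ?thesis unfolding N.emeasure_eq_measure by (rule ennreal_leI)
qed

lemma cos_ratio_strict_mono:
  fixes h k v :: real
  assumes "0 \<le> h" "h < k" "v > 0"
  shows "h / sqrt (h\<^sup>2 + v) < k / sqrt (k\<^sup>2 + v)"
proof -
  have pos: "h\<^sup>2 + v > 0" "k\<^sup>2 + v > 0" using assms by (auto intro: add_nonneg_pos)
  have "h\<^sup>2 < k\<^sup>2" using assms by (intro power_strict_mono) auto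
  then have "(h / sqrt (h\<^sup>2 + v))\<^sup>2 < (k / sqrt (k\<^sup>2 + v))\<^sup>2"
    using pos assms by (simp add: power_divide divide_less_eq less_divide_eq field_simps)
  then show ?thesis
    by (rule power2_less_imp_less) (use assms in simp)
qed

text \<open>The optimal tilt puts the mean of y on the boundary of the cone, where membership is not
  stable under small fluctuations. A slightly larger a moves it into the interior, and continuity of
  the total exponent charges at most e / 2. This also covers h = 0, since the perturbed component is
  positive.\<close>

lemma P_union_lower:
  assumes P: "P > 0" and s: "\<sigma> > 0" and h: "h = sqrt P + a" "h \<ge> 0" and v: "v > 0"
    and th: "cos th = h / sqrt (h\<^sup>2 + v)" and e: "e > 0"
  shows "\<forall>\<^sub>F n in sequentially.
    (real (ncw n R) - 1) * exp (- real n * (rate \<sigma> a v + ln (1 + h\<^sup>2 / v) / 2 + e)) \<le> P_union n P \<sigma> R th"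
proof -
  define F where "F = (\<lambda>a. rate \<sigma> a v + ln (1 + (sqrt P + a)\<^sup>2 / v) / 2)"
  have pos: "1 + (sqrt P + a)\<^sup>2 / v > 0" for a using v by (intro add_pos_nonneg) auto
  have "(F \<longlongrightarrow> F a) (at_right a)"
    unfolding F_def rate_def using s v pos[of a] by (intro tendsto_intros) auto
  then have "\<forall>\<^sub>F x in at_right a. F x < F a + e / 2"
    using e by (intro order_tendstoD(2)[of F "F a"]) auto
  moreover have "\<forall>\<^sub>F x in at_right a. a < x" by (rule eventually_at_right_less)
  ultimately have "\<forall>\<^sub>F x in at_right a. F x < F a + e / 2 \<and> a < x" by eventually_elim simp
  then obtain b where b: "F b < F a + e / 2" "a < b"
    using eventually_happens'[OF trivial_limit_at_right_real] by blast
  define k where "k = sqrt P + b"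
  have k: "k > h" "k > 0" using b h by (auto simp: k_def)
  have th': "0 \<le> cos th" "cos th < k / sqrt (k\<^sup>2 + v)"
    unfolding th using cos_ratio_strict_mono[OF h(2) k(1) v] h(2) v by auto
  have e2: "e / 2 > 0" using e by simp
  show ?thesis
    using pair_lower[OF P s k_def k(2) v th' e2] eventually_gt_at_top[of 0]
  proof eventually_elim
    case (elim n)
    let ?L = "exp (- real n * (rate \<sigma> b v + ln (1 + k\<^sup>2 / v) / 2 + e / 2))"
    have "(real (ncw n R) - 1) * ?L \<le> P_union n P \<sigma> R th"
      by (rule P_union_bounds(1)[OF s P elim(2), of ?L ?L]) (use elim(1) in auto)
    moreover have "exp (- real n * (rate \<sigma> a v + ln (1 + h\<^sup>2 / v) / 2 + e)) \<le> ?L"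
    proof -
      have "real n * (rate \<sigma> b v + ln (1 + k\<^sup>2 / v) / 2 + e / 2) \<le> real n * (rate \<sigma> a v + ln (1 + h\<^sup>2 / v) / 2 + e)"
        using b(1) unfolding F_def h(1) k_def by (intro mult_left_mono) auto
      then show ?thesis by simp
    qed
    then have "(real (ncw n R) - 1) * exp (- real n * (rate \<sigma> a v + ln (1 + h\<^sup>2 / v) / 2 + e)) \<le> (real (ncw n R) - 1) * ?L"
      using ncw_pos[of n R] by (intro mult_left_mono) auto
    ultimately show ?case by linarith
  qed
qed

text \<open>The union bound has exponent at most rate + cap - R, so a region exponent of at least
  rate + cap - r suffices when r \<le> R. The cone uses r = R, the half-space r = 0.\<close>

lemma P_region_le_P_union:
  assumes P: "P > 0" and s: "\<sigma> > 0" and h: "h = sqrt P + a" "h \<ge> 0" and v: "v > 0"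
    and th: "cos th = h / sqrt (h\<^sup>2 + v)" and R: "R > 0"
    and reg: "\<And>n. n > 0 \<Longrightarrow> P_region n P \<sigma> th \<le> exp (- real n * (rate \<sigma> a v + ln (1 + h\<^sup>2 / v) / 2 - r))"
    and r: "r \<le> R"
  shows "exp_le (\<lambda>n. P_region n P \<sigma> th) (\<lambda>n. P_union n P \<sigma> R th)"
proof (rule exp_leI)
  fix e :: real assume e: "e > 0"
  let ?K = "rate \<sigma> a v + ln (1 + h\<^sup>2 / v) / 2"
  have e2: "e / 2 > 0" using e by simp
  have "\<forall>\<^sub>F n in sequentially. exp (- real n * (e / 2)) \<le> 1 / 2" by (rule eventually_exp_decay[OF e2]) simp
  then show "\<forall>\<^sub>F n in sequentially. 0 < P_union n P \<sigma> R th \<longrightarrow> P_region n P \<sigma> th \<le> exp (real n * e) * P_union n P \<sigma> R th"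
    using P_union_lower[OF P s h v th e2, of R] eventually_gt_at_top[of 0]
  proof eventually_elim
    case (elim n)
    have "exp (real n * R) > 1" using elim(3) R by simp
    then have "real (ncw n R) > 1" using ncw_bounds(1)[of n R] by linarith
    then have "real (ncw n R) \<ge> 2" by simp
    \<comment> \<open>For N \<ge> 2 one has N - 1 \<ge> N / 2; a positive rate guarantees a second
      codeword.\<close>
    then have m: "exp (real n * R) / 2 \<le> real (ncw n R) - 1" using ncw_bounds(1)[of n R] by linarith
    have "exp (- real n * (?K - r)) \<le> exp (real n * e) * (exp (real n * R) / 2 * exp (- real n * (?K + e / 2)))"
    proof -
      have "real n * r \<le> real n * R" using r by (intro mult_left_mono) auto
      then have "exp (- real n * (?K - r)) \<le> exp (real n * R - real n * ?K)"
        unfolding exp_le_cancel_iff by (simp add: algebra_simps)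
      also have "\<dots> = exp (real n * e) * (exp (real n * R) * exp (- real n * (?K + e / 2)) * exp (- real n * (e / 2)))"
        unfolding exp_add[symmetric] by (simp add: algebra_simps)
      also have "\<dots> \<le> exp (real n * e) * (exp (real n * R) * exp (- real n * (?K + e / 2)) * (1 / 2))"
        using elim(1) by (intro mult_left_mono) auto
      finally show ?thesis by simp
    qed
    also have "\<dots> \<le> exp (real n * e) * ((real (ncw n R) - 1) * exp (- real n * (?K + e / 2)))"
      using m by (intro mult_left_mono mult_right_mono) auto
    also have "\<dots> \<le> exp (real n * e) * P_union n P \<sigma> R th"
      using elim(2) by (intro mult_left_mono) auto
    finally show ?case using reg[OF elim(3)] by linarith
  qed
qed (rule P_union_nonneg)

lemma (in gallager) P_region_le_P_union_cone:
  assumes R: "R > 0" and R\<beta>: "ln \<beta> / 2 = R" and th: "cos th \<ge> 0" "\<beta> * (sin th)\<^sup>2 = 1"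
  shows "exp_le (\<lambda>n. P_region n P \<sigma> th) (\<lambda>n. P_union n P \<sigma> R th)"
proof -
  \<comment> \<open>Weighting the noise density by the exponential evaluated in \<open>mgf_X\<close>
    yields the Gaussian with mean -(q - 1) / (q \<beta>) c and variance \<sigma>^2 / D; a and v are
    its parameters.\<close>
  define a where "a = - sqrt P * (q - 1) / (q * \<beta>)"
  define v where "v = \<sigma>\<^sup>2 / D"
  define h where "h = sqrt P + a"
  have v: "v > 0" using sig D_pos by (simp add: v_def)
  have qb: "q * \<beta> - q + 1 = \<beta> / D" using D_eq D_pos by (simp add: field_simps)
  have "h = sqrt P * (q * \<beta> - q + 1) / (q * \<beta>)"
    unfolding h_def a_def using q \<beta> by (simp add: field_simps)
  also have "\<dots> = sqrt P / (q * D)" unfolding qb using \<beta> by simp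
  finally have h: "h = sqrt P / (q * D)" .
  have h0: "h \<ge> 0" unfolding h using P q D_pos by simp
  have "h\<^sup>2 / v = snr / (q\<^sup>2 * D)"
    unfolding h v_def snr_def using P sig D_pos q by (simp add: power_divide power_mult_distrib field_simps power2_eq_square)
  also have "\<dots> = \<beta> - 1" using snr_eq q D_pos by (simp add: field_simps)
  \<comment> \<open>Hence the tilted angle has sin^2 = 1 / \<beta>, the boundary of the cone, and
    the cap exponent ln \<beta> / 2 = R cancels the number of codewords.\<close>
  finally have hv: "h\<^sup>2 / v = \<beta> - 1" .
  then have h2: "h\<^sup>2 = (\<beta> - 1) * v" using v by (simp add: field_simps)
  have hv2: "h\<^sup>2 + v = \<beta> * v" unfolding h2 by (simp add: algebra_simps)
  have s2: "(sin th)\<^sup>2 = 1 / \<beta>" using th(2) \<beta> by (simp add: field_simps)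
  have "(cos th)\<^sup>2 = (\<beta> - 1) / \<beta>" unfolding cos_squared_eq s2 using \<beta> by (simp add: field_simps)
  also have "\<dots> = (h / sqrt (h\<^sup>2 + v))\<^sup>2"
    unfolding hv2 unfolding power_divide h2 using \<beta> v by simp
  finally have c2: "(cos th)\<^sup>2 = (h / sqrt (h\<^sup>2 + v))\<^sup>2" .
  have "0 \<le> h / sqrt (h\<^sup>2 + v)"
    by (rule divide_nonneg_nonneg[OF h0]) (simp add: less_imp_le[OF v])
  from power2_eq_imp_eq[OF c2 th(1) this] have cth: "cos th = h / sqrt (h\<^sup>2 + v)" .
  \<comment> \<open>The Chernoff exponent of the region equals the relative entropy of its own
    tilted law, so the two bounds meet.\<close>
  have rt: "rate \<sigma> a v = E1"
  proof -
    have "(q - 1) / \<beta> = q - 1 / D" using D_eq2 D_pos by (simp add: field_simps)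
    then have "(q - 1) / (q * \<beta>) = (q - 1 / D) / q" by (metis divide_divide_eq_left mult.commute)
    then have a: "a = - sqrt P * ((q - 1 / D) / q)" unfolding a_def by (metis times_divide_eq_right)
    have "a\<^sup>2 / \<sigma>\<^sup>2 = snr * ((q - 1 / D) / q)\<^sup>2"
      unfolding a power_mult_distrib snr_def using P by simp
    also have "\<dots> = (\<beta> - 1) * D * (q - 1 / D)\<^sup>2"
      unfolding snr_eq using q by (simp add: power_divide)
    also have "\<dots> = (\<beta> - 1) * q\<^sup>2 * D - 2 * q * (\<beta> - 1) + (\<beta> - 1) / D"
      using D_pos by (simp add: power2_eq_square field_simps)
    also have "\<dots> = snr - 2 * q * (\<beta> - 1) + (q * \<beta> - q + 1 - 1 / D)"
      unfolding snr_eq[symmetric] qb by (simp add: diff_divide_distrib)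
    finally have 1: "a\<^sup>2 / \<sigma>\<^sup>2 = snr - 2 * q * (\<beta> - 1) + (q * \<beta> - q + 1 - 1 / D)" .
    have 2: "v / \<sigma>\<^sup>2 = 1 / D" using sig by (simp add: v_def)
    have "rate \<sigma> a v = (a\<^sup>2 / \<sigma>\<^sup>2 + v / \<sigma>\<^sup>2 - 1 - ln (v / \<sigma>\<^sup>2)) / 2"
      unfolding rate_def using sig by (simp add: field_simps)
    also have "\<dots> = E1" unfolding 1 2 E1_def using D_pos by (simp add: ln_div algebra_simps)
    finally show ?thesis .
  qed
  show ?thesis
  proof (rule P_region_le_P_union[OF P sig h_def h0 v cth R, of R])
    fix n :: nat assume n: "n > 0"
    have "rate \<sigma> a v + ln (1 + h\<^sup>2 / v) / 2 - R = E1" unfolding rt hv using R\<beta> by simp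
    then show "P_region n P \<sigma> th \<le> exp (- real n * (rate \<sigma> a v + ln (1 + h\<^sup>2 / v) / 2 - R))"
      using outside_cone_upper[OF n _ th] by (simp only:) (intro P_region_le[OF sig P n], auto)
  qed simp
qed

text \<open>Shifting the noise by -c without changing its variance makes y nearly orthogonal to c (h
  = 0). The shift costs snr / 2, the exponent of leaving the half-space, and the cap is nearly a
  hemisphere, so the union bound wins by the number of codewords.\<close>

lemma P_region_le_P_union_halfspace:
  assumes P: "P > 0" and s: "\<sigma> > 0" and R: "R > 0"
  shows "exp_le (\<lambda>n. P_region n P \<sigma> (pi / 2)) (\<lambda>n. P_union n P \<sigma> R (pi / 2))"
proof (rule P_region_le_P_union[of P \<sigma> 0 "- sqrt P" "\<sigma>\<^sup>2" _ R 0])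
  fix n :: nat assume n: "n > 0"
  have "rate \<sigma> (- sqrt P) (\<sigma>\<^sup>2) = P / \<sigma>\<^sup>2 / 2"
    using P s by (simp add: rate_def field_simps)
  then show "P_region n P \<sigma> (pi / 2) \<le> exp (- real n * (rate \<sigma> (- sqrt P) (\<sigma>\<^sup>2) + ln (1 + 0\<^sup>2 / \<sigma>\<^sup>2) / 2 - 0))"
    using halfspace_upper[OF s P n] by (simp, intro P_region_le[OF s P n]) auto
qed (use assms in auto)

section \<open>Stationary points of the exponent\<close>

text \<open>Here q is the positive root of the stationary equation at \<beta> = e^(2R). Its
  left-hand side increases in q once \<beta> q > snr, so comparison with q = 1 and q = 2 locates the
  root: \<beta> \<le> 1 + snr, that is R \<le> C, gives q \<ge> 1, and R above the critical rate
  gives q \<le> 2.\<close>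

lemma sp_stationary_point:
  fixes snr R :: real
  defines "\<beta> \<equiv> exp (2 * R)"
  defines "q \<equiv> snr / (2 * \<beta>) * (1 + sqrt (1 + 4 * \<beta> / (snr * (\<beta> - 1))))"
  assumes snr: "snr > 0" and R: "Rcrit snr < R" "R \<le> cap snr"
  shows "\<beta> > 1" "q \<ge> 1" "q \<le> 2" "(\<beta> - 1) * q * (\<beta> * q - snr) = snr"
proof -
  define W where "W = sqrt (1 + snr\<^sup>2 / 4)"
  have W2: "W\<^sup>2 = 1 + snr\<^sup>2 / 4" unfolding W_def by simp
  have W1: "W \<ge> 1" unfolding W_def by simp
  have W3: "W \<ge> snr / 2" unfolding W_def by (rule real_le_rsqrt) (simp add: power_divide)
  define b where "b = 1/2 + snr/4 + W/2"
  have "exp (2 * Rcrit snr) = b"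
    unfolding Rcrit_def W_def[symmetric] b_def[symmetric] using snr W1 by (simp add: b_def)
  then have \<beta>b: "\<beta> > b" unfolding \<beta>_def using R by (metis exp_less_cancel_iff mult_less_cancel_left_pos zero_less_numeral)
  then show \<beta>1: "\<beta> > 1" using W1 snr by (simp add: b_def)
  have "\<beta> \<le> exp (ln (1 + snr))" unfolding \<beta>_def using R by (simp add: cap_def)
  then have \<beta>c: "\<beta> \<le> 1 + snr" using snr by simp
  define V where "V = sqrt (1 + 4 * \<beta> / (snr * (\<beta> - 1)))"
  have V0: "1 + 4 * \<beta> / (snr * (\<beta> - 1)) \<ge> 0" using \<beta>1 snr by simp
  have V2: "V\<^sup>2 = 1 + 4 * \<beta> / (snr * (\<beta> - 1))" unfolding V_def using V0 by simp
  have qV: "2 * \<beta> * q - snr = snr * V" unfolding q_def V_def[symmetric] using \<beta>1 by (simp add: field_simps)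
  have q0: "q > 0" unfolding q_def V_def[symmetric] using \<beta>1 snr V0 by (intro mult_pos_pos) (auto simp: V_def add_pos_nonneg)
  have "(2 * \<beta> * q - snr)\<^sup>2 * (\<beta> - 1) = snr\<^sup>2 * (\<beta> - 1) + 4 * \<beta> * snr"
    unfolding qV power_mult_distrib V2 using \<beta>1 snr by (simp add: field_simps power2_eq_square)
  then have "4 * \<beta> * ((\<beta> - 1) * q * (\<beta> * q - snr)) = 4 * \<beta> * snr"
    by (simp add: power2_eq_square algebra_simps)
  then show st: "(\<beta> - 1) * q * (\<beta> * q - snr) = snr" using \<beta>1 by simp
  have "0 < (\<beta> - 1) * q * (\<beta> * q - snr)" unfolding st by (rule snr)
  moreover have "0 < (\<beta> - 1) * q" using \<beta>1 q0 by simp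
  ultimately have "0 < \<beta> * q - snr" by (rule zero_less_mult_pos)
  then have bq: "\<beta> * q > snr" by simp
  show "q \<ge> 1"
  proof (rule ccontr)
    assume "\<not> q \<ge> 1"
    then have q: "q < 1" by simp
    have "\<beta> * q < \<beta> * 1" using q \<beta>1 by simp
    then have 1: "\<beta> * q - snr < \<beta> - snr" by simp
    have "q * (\<beta> * q - snr) < 1 * (\<beta> - snr)"
      using q q0 bq 1 by (intro mult_strict_mono) auto
    then have "(\<beta> - 1) * (q * (\<beta> * q - snr)) < (\<beta> - 1) * (\<beta> - snr)" using \<beta>1 by simp
    also have "\<dots> \<le> (\<beta> - 1) * 1" using \<beta>1 \<beta>c by (intro mult_left_mono) auto
    also have "\<dots> \<le> snr" using \<beta>c by simp
    finally show False using st by (simp add: mult.assoc)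
  qed
  show "q \<le> 2"
  proof (rule ccontr)
    assume "\<not> q \<le> 2"
    then have q: "q > 2" by simp
    have "\<beta> * 2 < \<beta> * q" using q \<beta>1 by simp
    then have 1: "2 * \<beta> - snr < \<beta> * q - snr" by simp
    \<comment> \<open>Positivity at q = 2 is needed to multiply the strict inequalities for the two
      factors.\<close>
    have 0: "0 < 2 * \<beta> - snr" using \<beta>b W3 by (simp add: b_def)
    have "2 * (2 * \<beta> - snr) < q * (\<beta> * q - snr)"
      using q 0 1 by (intro mult_strict_mono) auto
    then have "(\<beta> - 1) * (2 * (2 * \<beta> - snr)) < (\<beta> - 1) * (q * (\<beta> * q - snr))" using \<beta>1 by simp
    also have "\<dots> = snr" using st by (simp add: mult.assoc)
    finally have 2: "(\<beta> - 1) * (2 * (2 * \<beta> - snr)) < snr" .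
    have "W < 2 * \<beta> - 1 - snr / 2" using \<beta>b by (simp add: b_def)
    then have "W\<^sup>2 < (2 * \<beta> - 1 - snr / 2)\<^sup>2" using W1 by (intro power_strict_mono) auto
    then show False using 2 unfolding W2 by (simp add: power2_eq_square algebra_simps)
  qed
qed

text \<open>The larger root of the stationary equation at q = 2. It equals exp (2 Rcrit), which is
  where the two regimes join.\<close>

lemma critical_stationary_point:
  fixes snr :: real
  defines "\<beta> \<equiv> (1 + snr / 2 + sqrt (1 + snr\<^sup>2 / 4)) / 2"
  assumes snr: "snr > 0"
  shows "\<beta> > 1" "(\<beta> - 1) * 2 * (\<beta> * 2 - snr) = snr"
proof -
  define W where "W = sqrt (1 + snr\<^sup>2 / 4)"
  have W2: "W * W = 1 + snr * snr / 4" using real_sqrt_mult_self[of "1 + snr\<^sup>2 / 4"] by (simp add: W_def power2_eq_square)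
  have W1: "W \<ge> 1" unfolding W_def by simp
  show "\<beta> > 1" unfolding \<beta>_def W_def[symmetric] using W1 snr by simp
  show "(\<beta> - 1) * 2 * (\<beta> * 2 - snr) = snr" unfolding \<beta>_def W_def[symmetric] using W2 by (simp add: field_simps)
qed

theorem theorem1:
  fixes P \<sigma> SNR R :: real
  assumes "P > 0" and "\<sigma> > 0" and "SNR = P / \<sigma>\<^sup>2"
    and "0 \<le> R" and "R \<le> cap SNR"
  shows "exp_le (\<lambda>n. P_union n P \<sigma> R (theta_r SNR R)) (\<lambda>n. exp (- real n * E_awgn_r R SNR))
     \<and> exp_le (\<lambda>n. P_region n P \<sigma> (theta_r SNR R)) (\<lambda>n. P_union n P \<sigma> R (theta_r SNR R))"
proof -
  have snr: "SNR > 0" using assms by simp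
  show ?thesis
  proof (cases "R \<le> Rcrit SNR")
    case True
    define \<beta> where "\<beta> = (1 + SNR / 2 + sqrt (1 + SNR\<^sup>2 / 4)) / 2"
    note st = critical_stationary_point[OF snr, folded \<beta>_def]
    interpret gallager P \<sigma> \<beta> 2
      by unfold_locales (use assms st in auto)
    have th: "theta_r SNR R = pi / 2" using True by (simp add: theta_r_def)
    \<comment> \<open>With \<rho> = 1 the rate term is ln \<beta> / 2 - R; \<beta> itself does not
      depend on R.\<close>
    have E: "E_awgn_r R SNR = E1 + ln \<beta> / 2 - R"
      using True assms(3) unfolding E_awgn_r_def E_r_def \<beta>_def[symmetric] E_G_def E1_def D_def snr_def
      by (simp add: field_simps)
    have "exp_le (\<lambda>n. P_region n P \<sigma> (pi / 2)) (\<lambda>n. P_union n P \<sigma> R (pi / 2))"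
    proof (cases "R = 0")
      case True
      show ?thesis by (rule exp_leI) (simp_all add: True P_union_rate_0)
    qed (use P_region_le_P_union_halfspace assms in auto)
    moreover have "exp_le (\<lambda>n. P_union n P \<sigma> R (pi / 2)) (\<lambda>n. exp (- real n * (E1 + ln \<beta> / 2 - R)))"
      by (rule P_union_upper) auto
    ultimately show ?thesis unfolding th E by simp
  next
    case False
    define \<beta> where "\<beta> = exp (2 * R)"
    define q where "q = SNR / (2 * \<beta>) * (1 + sqrt (1 + 4 * \<beta> / (SNR * (\<beta> - 1))))"
    have RR: "Rcrit SNR < R" using False by simp
    note st = sp_stationary_point[OF snr RR assms(5), folded \<beta>_def, folded q_def]
    interpret gallager P \<sigma> \<beta> q
      by unfold_locales (use assms st in auto)
    have R0: "R > 0" using st(1) by (simp add: \<beta>_def)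
    have th: "theta_r SNR R = theta R" using False by (simp add: theta_r_def)
    have x: "- 1 \<le> exp (- R)" "exp (- R) \<le> 1" using R0 exp_gt_zero[of "- R"] by (linarith, simp)
    have sin: "sin (theta R) = exp (- R)" unfolding theta_def using x by (intro sin_arcsin) auto
    have cos: "cos (theta R) \<ge> 0" unfolding theta_def using x by (subst cos_arcsin) (auto simp: abs_square_le_1)
    have b: "\<beta> * (sin (theta R))\<^sup>2 = 1"
      unfolding sin \<beta>_def by (simp add: exp_double[symmetric] exp_add[symmetric])
    have ln: "ln \<beta> / 2 = R" by (simp add: \<beta>_def)
    \<comment> \<open>The rate term vanishes for every \<rho> because ln \<beta> = 2 R, so both
      regimes share this form of the exponent.\<close>
    have E: "E_awgn_r R SNR = E1 + ln \<beta> / 2 - R"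
      using False assms(3) unfolding E_awgn_r_def E_sp_def Let_def \<beta>_def[symmetric] q_def[symmetric] E_G_def E1_def D_def snr_def
      using ln by (simp add: field_simps)
    have "exp_le (\<lambda>n. P_union n P \<sigma> R (theta R)) (\<lambda>n. exp (- real n * (E1 + ln \<beta> / 2 - R)))"
      by (rule P_union_upper[OF cos]) (use b st in auto)
    moreover have "exp_le (\<lambda>n. P_region n P \<sigma> (theta R)) (\<lambda>n. P_union n P \<sigma> R (theta R))"
      by (rule P_region_le_P_union_cone[OF R0 ln cos b])
    ultimately show ?thesis unfolding th E by simp
  qed
qed

end
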